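(* Let $(G_N)_{N\ge1}$ be a sequence of 2-regular configuration models $\mathrm{CM}_N(\mathbf 2)$. Then, for all $\beta\ge0$ and $B\in\mathbb R$, the total spin satisfies $$\frac{S_N-\widetilde P_N(S_N)}{\sqrt N}\ \xrightarrow{\ \mathcal D\ }\ \mathcal N(0,\chi)\qquad\text{w.r.t. }\widetilde P_N,\quad\text{as }N\to\infty,$$ where $\chi=\chi(\beta,B)$ is the thermodynamic limit of the quenched susceptibility of the Ising model on $\mathrm{CM}_N(\mathbf 2)$. Moreover, $\chi(\beta,B)$ is also equal to the susceptibility of the one-dimensional Ising model, i.e. $$\chi(\beta,B)=\chi^{d=1}(\beta,B)=\frac{\cosh(B)\,e^{-4\beta}}{(\sinh^2(B)+e^{-4\beta})^{3/2}}.$$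
   Context: Configuration model: given degrees $(d_i)_{i\in[N]}$ with even sum, attach $d_i$ half-edges to vertex $i\in[N]=\{1,\dots,N\}$ and pair all half-edges uniformly at random; each pair forms an edge, giving a random multigraph (self-loops and multiple edges allowed). $\mathrm{CM}_N(\mathbf 2)$ is the case $d_i=2$ for all $i\in[N]$. Annealed Ising model: let $Q_N$ denote the law of the random multigraph $G_N=([N],E_N)$ and also the corresponding expectation; $E_N$ is counted with multiplicity, and a self-loop at $i$ contributes a term $\sigma_i\sigma_i=1$ once. For $\beta\ge0$, $B\in\mathbb R$ the annealed measure on $\sigma\in\{-1,1\}^N$ is $$\widetilde P_N(\sigma)=\frac{Q_N\big(\exp[\beta\sum_{(i,j)\in E_N}\sigma_i\sigma_j+B\sum_{i\in[N]}\sigma_i]\big)}{Q_N(Z_N(\beta,B))},\qquad Z_N(\beta,B)=\sum_{\sigma\in\{-1,1\}^N}\exp\Big[\beta\sum_{(i,j)\in E_N}\sigma_i\sigma_j+B\sum_{i\in[N]}\sigma_i\Big].$$ $\widetilde P_N(\cdot)$ also denotes expectation; $S_N=\sum_{i\in[N]}\sigma_i$ is the total spin; $\mathcal N(0,\sigma^2)$ is a centered normal variable with variance $\sigma^2$. Quenched susceptibility: for a realization of $G_N$ let $\mu_{G_N}(\sigma)=\exp[\beta\sum_{(i,j)\in E_N}\sigma_i\sigma_j+B\sum_i\sigma_i]/Z_N(\beta,B)$; the quenched susceptibility is $\chi_N(\beta,B)=\mathrm{Var}_{\mu_{G_N}}(S_N/\sqrt N)$ and its thermodynamic limit is the (non-random,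 almost sure) limit $\chi(\beta,B)=\lim_{N\to\infty}\chi_N(\beta,B)$. One-dimensional Ising susceptibility: $\chi^{d=1}(\beta,B)=\frac{\partial^2}{\partial B^2}\log\lambda_+(\beta,B)$ with $\lambda_+(\beta,B)=e^{\beta}\big[\cosh(B)+\sqrt{\sinh^2(B)+e^{-4\beta}}\big]$, $\log\lambda_+$ being the pressure of the one-dimensional Ising model. *)

theory Defs
  imports "HOL-Probability.Probability"
begin

section \<open>Multigraphs and the configuration model\<close>

text \<open>
  A multigraph on the vertex set \<open>{1..N}\<close> is given by its multiset of edges; an edge is the two-element
  multiset of its endpoints, so that a self-loop at \<open>i\<close> is \<open>{#i, i#}\<close>.
\<close>

type_synonym multigraph = "nat multiset multiset"

definition half_edges :: "nat \<Rightarrow> (nat \<Rightarrow> nat) \<Rightarrow> (nat \<times> nat) set" where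
  "half_edges N d = (SIGMA i:{1..N}. {..<d i})"

definition pairings :: "'a set \<Rightarrow> 'a set set set" where
  "pairings H = {P. partition_on H P \<and> (\<forall>e\<in>P. card e = 2)}"

definition multigraph_of :: "(nat \<times> nat) set set \<Rightarrow> multigraph" where
  "multigraph_of P = image_mset (\<lambda>e. image_mset fst (mset_set e)) (mset_set P)"

text \<open>
  The law of the configuration model. It is meaningful only if the sum of the degrees is even, since
  otherwise there are no pairings; see \<open>pairings_nonempty\<close> below.
\<close>

definition CM :: "nat \<Rightarrow> (nat \<Rightarrow> nat) \<Rightarrow> multigraph pmf" where
  "CM N d = map_pmf multigraph_of (pmf_of_set (pairings (half_edges N d)))"

section \<open>The Ising model\<close>

definition spin_configs :: "nat \<Rightarrow> (nat \<Rightarrow> real) set" where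
  "spin_configs N = {1..N} \<rightarrow>\<^sub>E {-1, 1}"

definition total_spin :: "nat \<Rightarrow> (nat \<Rightarrow> real) \<Rightarrow> real" where
  "total_spin N \<sigma> = (\<Sum>i\<in>{1..N}. \<sigma> i)"

definition boltzmann_weight ::
  "nat \<Rightarrow> real \<Rightarrow> real \<Rightarrow> multigraph \<Rightarrow> (nat \<Rightarrow> real) \<Rightarrow> real" where
  "boltzmann_weight N \<beta> B E \<sigma> =
     exp (\<beta> * (\<Sum>e\<in>#E. \<Prod>i\<in>#e. \<sigma> i) + B * (\<Sum>i\<in>{1..N}. \<sigma> i))"

definition partition_function :: "nat \<Rightarrow> real \<Rightarrow> real \<Rightarrow> multigraph \<Rightarrow> real" where
  "partition_function N \<beta> B E = (\<Sum>\<sigma>\<in>spin_configs N. boltzmann_weight N \<beta> B E \<sigma>)"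

definition quenched_measure ::
  "nat \<Rightarrow> real \<Rightarrow> real \<Rightarrow> multigraph \<Rightarrow> (nat \<Rightarrow> real) measure" where
  "quenched_measure N \<beta> B E = point_measure (spin_configs N)
     (\<lambda>\<sigma>. ennreal (boltzmann_weight N \<beta> B E \<sigma> / partition_function N \<beta> B E))"

definition quenched_susceptibility :: "nat \<Rightarrow> real \<Rightarrow> real \<Rightarrow> multigraph \<Rightarrow> real" where
  "quenched_susceptibility N \<beta> B E =
     prob_space.variance (quenched_measure N \<beta> B E) (\<lambda>\<sigma>. total_spin N \<sigma> / sqrt (real N))"

definition annealed_measure ::
  "multigraph pmf \<Rightarrow> nat \<Rightarrow> real \<Rightarrow> real \<Rightarrow> (nat \<Rightarrow> real) measure" where
  "annealed_measure Q N \<beta> B = point_measure (spin_configs N)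
     (\<lambda>\<sigma>. ennreal (measure_pmf.expectation Q (\<lambda>E. boltzmann_weight N \<beta> B E \<sigma>)
                   / measure_pmf.expectation Q (partition_function N \<beta> B)))"

section \<open>The one-dimensional Ising model\<close>

definition lambda_plus :: "real \<Rightarrow> real \<Rightarrow> real" where
  "lambda_plus \<beta> B = exp \<beta> * (cosh B + sqrt ((sinh B)\<^sup>2 + exp (- 4 * \<beta>)))"

definition susceptibility_1d :: "real \<Rightarrow> real \<Rightarrow> real" where
  "susceptibility_1d \<beta> B = (deriv ^^ 2) (\<lambda>b. ln (lambda_plus \<beta> b)) B"

section \<open>Well-definedness\<close>

lemma finite_half_edges: "finite (half_edges N d)"
  by (auto simp: half_edges_def)

lemma card_half_edges: "card (half_edges N d) = (\<Sum>i\<in>{1..N}. d i)"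
  by (simp add: half_edges_def)

lemma finite_pairings: "finite H \<Longrightarrow> finite (pairings H)"
  by (rule finite_subset[of _ "Pow (Pow H)"]) (auto simp: pairings_def partition_on_def)

lemma pairings_nonempty:
  assumes "finite H" "even (card H)"
  shows "pairings H \<noteq> {}"
  using assms
proof (induction "card H" arbitrary: H rule: less_induct)
  case less
  show ?case
  proof (cases "H = {}")
    case True
    then show ?thesis by (auto simp: pairings_def partition_on_empty)
  next
    case False
    with less.prems have "card H \<ge> 2"
      by (metis One_nat_def card_0_eq less_2_cases linorder_not_le odd_one)
    then obtain K where K: "K \<subseteq> H" "card K = 2" by (meson obtain_subset_with_card_n)
    have fK: "finite K" using K less.prems finite_subset by blast
    have c: "card (H - K) = card H - 2" using K fK by (simp add: card_Diff_subset)
    have "pairings (H - K) \<noteq> {}"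
      using less.hyps[of "H - K"] less.prems c \<open>card H \<ge> 2\<close> by simp
    then obtain P where P: "partition_on (H - K) P" "\<forall>e\<in>P. card e = 2"
      by (auto simp: pairings_def)
    have "disjnt K q" if "q \<in> P" for q
      using that P(1) by (auto simp: partition_on_def disjnt_def)
    moreover have "K \<noteq> {}"
      using K by auto
    ultimately have "partition_on H (insert K P)"
      using P(1) K by (subst partition_on_insert) (auto simp: disjnt_def partition_on_def)
    then show ?thesis using P(2) K by (auto simp: pairings_def)
  qed
qed

lemma set_pmf_CM:
  assumes "even (\<Sum>i\<in>{1..N}. d i)"
  shows "set_pmf (CM N d) = multigraph_of ` pairings (half_edges N d)"
  using assms
  by (simp add: CM_def finite_pairings finite_half_edges pairings_nonempty card_half_edges)

lemma finite_spin_configs: "finite (spin_configs N)"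
  by (auto simp: spin_configs_def intro!: finite_PiE)

lemma spin_configs_nonempty: "spin_configs N \<noteq> {}"
  by (auto simp: spin_configs_def PiE_eq_empty_iff)

lemma partition_function_pos: "partition_function N \<beta> B E > 0"
  unfolding partition_function_def boltzmann_weight_def
  by (intro sum_pos finite_spin_configs spin_configs_nonempty) auto

lemma prob_space_quenched_measure: "prob_space (quenched_measure N \<beta> B E)"
  unfolding quenched_measure_def
proof (rule prob_space_point_measure)
  let ?Z = "partition_function N \<beta> B E"
  have "(\<Sum>\<sigma>\<in>spin_configs N. ennreal (boltzmann_weight N \<beta> B E \<sigma> / ?Z))
      = ennreal (\<Sum>\<sigma>\<in>spin_configs N. boltzmann_weight N \<beta> B E \<sigma> / ?Z)"
    using partition_function_pos[of N \<beta> B E]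
    by (intro sum_ennreal) (simp add: boltzmann_weight_def)
  also have "(\<Sum>\<sigma>\<in>spin_configs N. boltzmann_weight N \<beta> B E \<sigma> / ?Z) = ?Z / ?Z"
    unfolding partition_function_def by (rule sum_divide_distrib[symmetric])
  also have "?Z / ?Z = 1"
    using partition_function_pos[of N \<beta> B E] by simp
  finally show "(\<Sum>\<sigma>\<in>spin_configs N. ennreal (boltzmann_weight N \<beta> B E \<sigma> / ?Z)) = 1"
    by simp
qed (auto simp: finite_spin_configs)

lemma prob_space_annealed_measure:
  assumes "finite (set_pmf Q)"
  shows "prob_space (annealed_measure Q N \<beta> B)"
  unfolding annealed_measure_def
proof (rule prob_space_point_measure)
  let ?w = "\<lambda>\<sigma>. measure_pmf.expectation Q (\<lambda>E. boltzmann_weight N \<beta> B E \<sigma>)"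
  let ?Z = "measure_pmf.expectation Q (partition_function N \<beta> B)"
  have Z: "?Z = (\<Sum>\<sigma>\<in>spin_configs N. ?w \<sigma>)"
    unfolding partition_function_def
    by (rule Bochner_Integration.integral_sum) (rule integrable_measure_pmf_finite[OF assms])
  have w: "?w \<sigma> > 0" for \<sigma>
  proof -
    have "?w \<sigma> = (\<Sum>E\<in>set_pmf Q. boltzmann_weight N \<beta> B E \<sigma> * pmf Q E)"
      using assms by (rule integral_measure_pmf_real) auto
    also have "\<dots> > 0"
      using assms set_pmf_not_empty
      by (intro sum_pos mult_pos_pos pmf_positive) (auto simp: boltzmann_weight_def)
    finally show ?thesis .
  qed
  have Zpos: "?Z > 0"
    unfolding Z by (intro sum_pos finite_spin_configs spin_configs_nonempty w)
  have "(\<Sum>\<sigma>\<in>spin_configs N. ennreal (?w \<sigma> / ?Z)) = ennreal (\<Sum>\<sigma>\<in>spin_configs N. ?w \<sigma> / ?Z)"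
    by (intro sum_ennreal divide_nonneg_pos Zpos less_imp_le[OF w])
  also have "(\<Sum>\<sigma>\<in>spin_configs N. ?w \<sigma> / ?Z) = ?Z / ?Z"
    unfolding Z by (rule sum_divide_distrib[symmetric])
  also have "?Z / ?Z = 1"
    using Zpos by simp
  finally show "(\<Sum>\<sigma>\<in>spin_configs N. ennreal (?w \<sigma> / ?Z)) = 1"
    by simp
qed (auto simp: finite_spin_configs)

end

theory Submission
  imports Defs "HOL-Real_Asymp.Real_Asymp"
begin

text \<open>
  A 2-regular multigraph is a disjoint union of cycles, and the Ising partition function of a cycle
  of length \<open>L\<close> is the trace of the \<open>L\<close>-th power of the one-dimensional transfer matrix. With \<open>x\<close> its
  larger eigenvalue and \<open>q = y / x\<close> the ratio of the eigenvalues, so that \<open>0 \<le> q < 1\<close>, the partition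
  function of the whole graph is \<open>x ^ N\<close> times the product of \<open>1 + q ^ L\<close> over the cycle lengths \<open>L\<close>
  (lemmas \<open>cycle_decomposition\<close>, \<open>cycle_weight_eigenvalues\<close>). The first factor is that of the
  one-dimensional model; everything else is a correction, and the proof bounds this correction in
  the quenched and in the annealed setting.

  Quenched: \<open>N\<close> times the susceptibility is the second derivative in \<open>B\<close> of the logarithm of the
  partition function. Each cycle contributes at most a constant to the second derivative
  of the correction, whatever its length, because \<open>L\<^sup>2 * q ^ L\<close> is bounded
  (lemma \<open>quenched_susceptibility_bound\<close>). The number \<open>K\<close> of cycles satisfies \<open>E[2 ^ K] \<le> 2 * N\<close>,
  so by Borel-Cantelli, which needs only the law of each graph, \<open>K\<close> is almost surely of order at most
  \<open>ln N\<close>, and the susceptibility converges (lemma \<open>quenched_susceptibility_tendsto\<close>).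

  Annealed: exploring the cycle through a given vertex gives a recursion for the sum of the
  partition functions over all pairings. Up to the factor \<open>2 ^ N * N!\<close>, it is solved by the Taylor
  coefficients of
  \<open>(1 - x * z) powr (- 1 / 2) * (1 - y * z) powr (- 1 / 2)\<close> in \<open>z\<close>
  (lemma \<open>sum_closed_weight\<close>). Hence the averaged partition function is \<open>x ^ N\<close> times a polynomial in
  \<open>q\<close>, with coefficients in \<open>[0, 1]\<close>, that converges as \<open>N\<close> tends to infinity
  (lemmas \<open>annealed_tilted\<close>, \<open>cycle_series_lim\<close>). The combinatorial identities hold over any field of
  characteristic zero. Evaluated at the complex magnetic field \<open>B + \<i> * t / sqrt N\<close> they give the
  characteristic function of the normalized total spin: the polynomial contributes a factor that
  tends to 1, and the second-order expansion of the logarithm of \<open>x\<close> gives the Gaussian limit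
  (lemma \<open>annealed_char_tendsto\<close>). Levy's continuity theorem concludes.
\<close>

section \<open>Pairings\<close>

lemma pairings_insertI:
  assumes "P \<in> pairings (H - {a, b})" "a \<in> H" "b \<in> H" "a \<noteq> b"
  shows "insert {a, b} P \<in> pairings H"
proof -
  have P: "partition_on (H - {a, b}) P" "\<forall>e\<in>P. card e = 2"
    using assms by (auto simp: pairings_def)
  have "disjnt {a, b} e" if "e \<in> P" for e
    using that P(1) by (auto simp: partition_on_def disjnt_def)
  then have "partition_on H (insert {a, b} P)"
    using P(1) assms by (subst partition_on_insert) (auto simp: partition_on_def disjnt_def)
  then show ?thesis
    using P assms by (auto simp: pairings_def)
qed

lemma pairingsE:
  assumes "P \<in> pairings H" "a \<in> H"
  obtains b P' where "b \<in> H - {a}" "P' \<in> pairings (H - {a, b})" "P = insert {a, b} P'"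
proof -
  have P: "partition_on H P" "\<forall>e\<in>P. card e = 2"
    using assms by (auto simp: pairings_def)
  obtain e where e: "e \<in> P" "a \<in> e"
    using P(1) assms(2) by (auto simp: partition_on_def)
  then obtain u v where "e = {u, v}" "u \<noteq> v"
    using P(2) e(1) by (meson card_2_iff)
  then obtain b where b: "e = {a, b}" "b \<noteq> a"
    using e(2) by blast
  have P_eq: "P = insert {a, b} (P - {{a, b}})"
    using e b by auto
  have disj: "{a, b} \<inter> e' = {}" if "e' \<in> P - {{a, b}}" for e'
    using P(1) e b that by (intro disjointD[of P]) (auto simp: partition_on_def)
  have "H = {a, b} \<union> \<Union>(P - {{a, b}})"
    using P(1) P_eq by (metis Union_insert partition_on_def)
  then have "\<Union>(P - {{a, b}}) = H - {a, b}"
    using disj by blast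
  then have "partition_on (H - {a, b}) (P - {{a, b}})"
    using P(1) by (auto simp: partition_on_def disjoint_def)
  then have "P - {{a, b}} \<in> pairings (H - {a, b})"
    using P(2) by (auto simp: pairings_def)
  moreover have "b \<in> H - {a}"
    using e b P(1) by (auto simp: partition_on_def)
  ultimately show thesis
    using that P_eq by blast
qed

text \<open>
  Conditioning on the partner of one fixed half-edge. All recursions below come from this identity.
\<close>
lemma sum_pairings:
  assumes "finite H" "a \<in> H"
  shows "sum F (pairings H)
    = (\<Sum>b\<in>H - {a}. \<Sum>P\<in>pairings (H - {a, b}). F (insert {a, b} P))"
proof -
  let ?S = "SIGMA b:H - {a}. pairings (H - {a, b})"
  let ?f = "\<lambda>(b, P). insert {a, b} P"
  have a_notin: "a \<notin> e" if "P \<in> pairings (H - {a, b})" "e \<in> P" for P b e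
    using that by (auto simp: pairings_def partition_on_def)
  have inj: "inj_on ?f ?S"
  proof (rule inj_onI)
    fix q q' assume q: "q \<in> ?S" "q' \<in> ?S" "?f q = ?f q'"
    obtain b P b' P' where bP: "q = (b, P)" "q' = (b', P')"
      by (cases q, cases q')
    have *: "P \<in> pairings (H - {a, b})" "P' \<in> pairings (H - {a, b'})"
      "insert {a, b} P = insert {a, b'} P'"
      using q unfolding bP by auto
    have "{a, b} = {a, b'}"
      using * a_notin by (metis insertCI insertE)
    then have "b = b'" by (auto simp: doubleton_eq_iff)
    moreover have "{a, b} \<notin> P" "{a, b'} \<notin> P'"
      using a_notin * by blast+
    ultimately show "q = q'"
      using *(3) unfolding bP by (auto simp: insert_ident)
  qed
  have "?f ` ?S = pairings H"
  proof
    show "?f ` ?S \<subseteq> pairings H"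
      using assms by (auto intro!: pairings_insertI)
    show "pairings H \<subseteq> ?f ` ?S"
    proof
      fix P assume "P \<in> pairings H"
      from this assms(2) obtain b P'
        where "b \<in> H - {a}" "P' \<in> pairings (H - {a, b})" "P = insert {a, b} P'"
        by (rule pairingsE)
      then show "P \<in> ?f ` ?S"
        by (intro image_eqI[of _ _ "(b, P')"]) auto
    qed
  qed
  then have "sum F (pairings H) = (\<Sum>q\<in>?S. F (?f q))"
    using sum.reindex[OF inj, of F] by (simp add: o_def)
  also have "\<dots> = (\<Sum>b\<in>H - {a}. \<Sum>P\<in>pairings (H - {a, b}). F (insert {a, b} P))"
    using assms by (subst sum.Sigma) (auto simp: finite_pairings split_beta)
  finally show ?thesis .
qed

lemma pairings_empty: "pairings {} = {{}}"
  by (auto simp: pairings_def partition_on_empty)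

lemma sum_PiE_insert:
  assumes "finite V" "v \<notin> V"
  shows "(\<Sum>\<sigma>\<in>insert v V \<rightarrow>\<^sub>E S. F \<sigma>) = (\<Sum>x\<in>S. \<Sum>\<sigma>\<in>V \<rightarrow>\<^sub>E S. F (\<sigma>(v := x)))"
proof -
  have "(\<Sum>\<sigma>\<in>insert v V \<rightarrow>\<^sub>E S. F \<sigma>)
      = (\<Sum>q\<in>S \<times> (V \<rightarrow>\<^sub>E S). F ((snd q)(v := fst q)))"
    using assms
    by (subst PiE_insert_eq, subst sum.reindex)
       (auto simp: inj_combinator o_def split_beta intro!: inj_combinator)
  then show ?thesis
    by (simp add: sum.cartesian_product split_beta)
qed

section \<open>Spin weights along explored paths\<close>

definition two_half_edges where "two_half_edges V = V \<times> {..<2::nat}"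

text \<open>
  The following weights depend on a function \<open>w\<close> of the product of the two spins at an edge and on a
  function \<open>m\<close> of the spin at a vertex. The Ising model is \<open>w u = exp (\<beta> * u)\<close> and
  \<open>m u = exp (B * u)\<close>; other choices of \<open>w\<close> and \<open>m\<close> count pairings and cycles. The values lie in an
  arbitrary field so that complex magnetic fields are covered.

  Entry \<open>(x, y)\<close> of the transfer matrix of a path with \<open>n\<close> edges, hence \<open>Suc n\<close> vertices, whose end
  spins are \<open>x\<close> and \<open>y\<close>.
\<close>
primrec path_weight :: "(real \<Rightarrow> 'f::field_char_0) \<Rightarrow> (real \<Rightarrow> 'f) \<Rightarrow> nat \<Rightarrow> real \<Rightarrow> real \<Rightarrow> 'f" where
  "path_weight w m 0 x y = (if x = y then m x else 0)"
| "path_weight w m (Suc n) x y = (\<Sum>z\<in>{-1, 1}. path_weight w m n x z * w (z * y) * m y)"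

text \<open>
  The cycle with \<open>Suc n\<close> vertices, obtained by joining the two ends of a path with \<open>n\<close> edges. Indexing
  by \<open>n\<close> makes the self-loop the case \<open>n = 0\<close> and excludes cycles of length zero.
\<close>
definition cycle_weight :: "(real \<Rightarrow> 'f::field_char_0) \<Rightarrow> (real \<Rightarrow> 'f) \<Rightarrow> nat \<Rightarrow> 'f" where
  "cycle_weight w m n = (\<Sum>x\<in>{-1, 1}. \<Sum>y\<in>{-1, 1}. path_weight w m n x y * w (x * y))"

text \<open>
  The hypotheses say that \<open>x\<close> and \<open>y\<close> have the trace and the determinant of the transfer matrix. By
  Cayley-Hamilton, both sides satisfy the same linear recurrence of order two.
\<close>
lemma cycle_weight_eigenvalues:
  assumes "x + y = w 1 * (m 1 + m (- 1))"
    and "x * y = m 1 * m (- 1) * ((w 1)\<^sup>2 - (w (- 1))\<^sup>2)"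
  shows "cycle_weight w m n = x ^ Suc n + y ^ Suc n"
proof -
  \<comment> \<open>multiplication by the transfer matrix, which annihilates its characteristic polynomial\<close>
  have CH: "path_weight w m (Suc (Suc n)) a b
      = (x + y) * path_weight w m (Suc n) a b - x * y * path_weight w m n a b"
    if "b \<in> {-1, 1}" for a b n
    using that unfolding assms by (auto simp: algebra_simps power2_eq_square)
  show ?thesis
  proof (induction n rule: induct_nat_012)
    case 0
    show ?case using assms(1) by (simp add: cycle_weight_def algebra_simps)
  next
    case 1
    have "x ^ 2 + y ^ 2 = (x + y)\<^sup>2 - 2 * (x * y)"
      by (simp add: power2_eq_square algebra_simps)
    also have "\<dots> = cycle_weight w m 1"
      unfolding assms by (simp add: cycle_weight_def algebra_simps power2_eq_square)
    finally show ?case by (simp add: numeral_2_eq_2)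
  next
    case (ge2 n)
    have "cycle_weight w m (Suc (Suc n))
        = (x + y) * cycle_weight w m (Suc n) - x * y * cycle_weight w m n"
      unfolding cycle_weight_def sum_distrib_left sum_subtractf[symmetric]
      by (intro sum.cong refl) (simp only: CH, simp only: algebra_simps)
    then show ?case
      unfolding ge2 by (simp add: algebra_simps)
  qed
qed

text \<open>
  A pairing of the half-edges of \<open>V\<close> is explored by following one cycle at a time.
  In \<open>closed_weight\<close> no cycle is partially explored. In \<open>open_weight\<close> a path with \<open>n\<close> edges has been
  explored, with free half-edges \<open>a\<close> and \<open>b\<close> at its ends; its inner spins are already summed out, and
  \<open>V\<close> holds the vertices not yet visited.
\<close>
definition closed_weight ::
  "(real \<Rightarrow> 'f::field_char_0) \<Rightarrow> (real \<Rightarrow> 'f) \<Rightarrow> 'v set \<Rightarrow> ('v \<times> nat) set set \<Rightarrow> 'f" where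
  "closed_weight w m V P = (\<Sum>\<sigma>\<in>V \<rightarrow>\<^sub>E {-1, 1}. (\<Prod>v\<in>V. m (\<sigma> v)) *
     (\<Prod>e\<in>P. w (\<Prod>h\<in>e. \<sigma> (fst h))))"

definition open_weight ::
  "(real \<Rightarrow> 'f::field_char_0) \<Rightarrow> (real \<Rightarrow> 'f) \<Rightarrow> 'v set \<Rightarrow> 'v \<times> nat \<Rightarrow> 'v \<times> nat \<Rightarrow> nat
    \<Rightarrow> ('v \<times> nat) set set \<Rightarrow> 'f" where
  "open_weight w m V a b n P = (\<Sum>x\<in>{-1, 1}. \<Sum>y\<in>{-1, 1}. path_weight w m n x y *
     (\<Sum>\<sigma>\<in>V \<rightarrow>\<^sub>E {-1, 1}. (\<Prod>v\<in>V. m (\<sigma> v)) *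
        (\<Prod>e\<in>P. w (\<Prod>h\<in>e. if h = a then x else if h = b then y else \<sigma> (fst h)))))"

lemma pairing_elem: "P \<in> pairings H \<Longrightarrow> e \<in> P \<Longrightarrow> h \<in> e \<Longrightarrow> h \<in> H"
  by (auto simp: pairings_def partition_on_def)

lemma finite_pairing: "finite H \<Longrightarrow> P \<in> pairings H \<Longrightarrow> finite P"
  using finite_elements[of H P] by (simp add: pairings_def)

lemma finite_two_half_edges [simp]: "finite V \<Longrightarrow> finite (two_half_edges V)"
  by (simp add: two_half_edges_def)

text \<open>
  The three steps of the exploration are to start a path at a new vertex, to close it by
  joining its two ends, and to extend it through a half-edge of a new vertex \<open>v\<close>. In the last step the
  other half-edge \<open>1 - i\<close> of \<open>v\<close> becomes the end of the path.
\<close>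
lemma closed_weight_insert:
  assumes "finite V" "v \<notin> V" "P \<in> pairings (two_half_edges (insert v V))"
  shows "closed_weight w m (insert v V) P = open_weight w m V (v, 0) (v, 1) 0 P"
proof -
  have spin: "(\<Prod>h\<in>e. (\<sigma>(v := x)) (fst h))
      = (\<Prod>h\<in>e. if h = (v, 0) then x else if h = (v, 1) then x else \<sigma> (fst h))"
    if "e \<in> P" for e x and \<sigma> :: "'a \<Rightarrow> real"
    using pairing_elem[OF assms(3) that]
    by (intro prod.cong refl) (force simp: two_half_edges_def less_2_cases_iff)
  have verts: "(\<Prod>u\<in>insert v V. m ((\<sigma>(v := x)) u)) = m x * (\<Prod>u\<in>V. m (\<sigma> u))" for \<sigma> and x
    using assms by (auto intro!: prod.cong)
  have "closed_weight w m (insert v V) P = (\<Sum>x\<in>{-1, 1}. m x * (\<Sum>\<sigma>\<in>V \<rightarrow>\<^sub>E {-1, 1}.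
      (\<Prod>v\<in>V. m (\<sigma> v)) *
      (\<Prod>e\<in>P. w (\<Prod>h\<in>e. if h = (v, 0) then x else if h = (v, 1) then x else \<sigma> (fst h)))))"
    unfolding closed_weight_def sum_PiE_insert[OF assms(1,2)] verts sum_distrib_left
    by (intro sum.cong refl) (simp add: spin mult.assoc del: fun_upd_apply cong: prod.cong)
  then show ?thesis
    by (simp add: open_weight_def del: One_nat_def)
qed

lemma open_weight_close:
  assumes "finite V" "P \<in> pairings (two_half_edges V)" "a \<noteq> b"
    "a \<notin> two_half_edges V" "b \<notin> two_half_edges V"
  shows "open_weight w m V a b n (insert {a, b} P) = cycle_weight w m n * closed_weight w m V P"
proof -
  have fin: "finite P"
    using assms by (intro finite_pairing[OF _ assms(2)]) auto
  have new: "{a, b} \<notin> P"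
    using pairing_elem[OF assms(2)] assms(4) by blast
  have spin: "(\<Prod>h\<in>e. if h = a then x else if h = b then y else \<sigma> (fst h)) = (\<Prod>h\<in>e. \<sigma> (fst h))"
    if "e \<in> P" for e x y and \<sigma> :: "'a \<Rightarrow> real"
    using pairing_elem[OF assms(2) that] assms by (intro prod.cong refl) auto
  have weight: "(\<Prod>e\<in>insert {a, b} P. w (\<Prod>h\<in>e. if h = a then x else if h = b then y else \<sigma> (fst h)))
     = w (x * y) * (\<Prod>e\<in>P. w (\<Prod>h\<in>e. \<sigma> (fst h)))" for x y and \<sigma> :: "'a \<Rightarrow> real"
    using assms fin new by (simp add: spin cong: prod.cong)
  show ?thesis
    unfolding open_weight_def weight cycle_weight_def closed_weight_def sum_distrib_right
    by (intro sum.cong refl) (simp add: sum_distrib_left mult_ac)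
qed

lemma open_weight_extend:
  assumes "finite V" "v \<notin> V" "i < 2" "a \<noteq> b"
    "P \<in> pairings (insert a (insert (v, 1 - i) (two_half_edges V)))"
    "a \<notin> two_half_edges (insert v V)" "b \<notin> two_half_edges (insert v V)"
  shows "open_weight w m (insert v V) a b n (insert {b, (v, i)} P)
       = open_weight w m V a (v, 1 - i) (Suc n) P"
proof -
  have i: "1 - i \<noteq> i" using assms(3) by presburger
  have fin: "finite P"
    using assms by (intro finite_pairing[OF _ assms(5)]) auto
  have new: "{b, (v, i)} \<notin> P"
    using pairing_elem[OF assms(5), of "{b, (v, i)}" b] assms
    by (auto simp: two_half_edges_def)
  have ne: "a \<noteq> (v, i)" "a \<noteq> (v, 1 - i)" "b \<noteq> (v, i)" "b \<noteq> (v, 1 - i)"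
    using assms by (auto simp: two_half_edges_def)
  have spin: "(\<Prod>h\<in>e. if h = a then x else if h = b then y else (\<sigma>(v := z)) (fst h))
      = (\<Prod>h\<in>e. if h = a then x else if h = (v, 1 - i) then z else \<sigma> (fst h))"
    if "e \<in> P" for e x y z and \<sigma> :: "'a \<Rightarrow> real"
    using pairing_elem[OF assms(5) that] assms by (intro prod.cong refl) (force simp: two_half_edges_def)
  have weight: "(\<Prod>e\<in>insert {b, (v, i)} P.
        w (\<Prod>h\<in>e. if h = a then x else if h = b then y else (\<sigma>(v := z)) (fst h)))
     = w (y * z) * (\<Prod>e\<in>P. w (\<Prod>h\<in>e. if h = a then x else if h = (v, 1 - i) then z else \<sigma> (fst h)))"
    for x y z and \<sigma> :: "'a \<Rightarrow> real"
    unfolding prod.insert[OF fin new]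
    using assms ne by (simp add: spin cong: prod.cong)
  have verts: "(\<Prod>u\<in>insert v V. m ((\<sigma>(v := x)) u)) = m x * (\<Prod>u\<in>V. m (\<sigma> u))" for \<sigma> and x
    using assms by (auto intro!: prod.cong)
  define T where "T x z = (\<Sum>\<sigma>\<in>V \<rightarrow>\<^sub>E {-1, 1}. (\<Prod>u\<in>V. m (\<sigma> u)) *
      (\<Prod>e\<in>P. w (\<Prod>h\<in>e. if h = a then x else if h = (v, 1 - i) then z else \<sigma> (fst h))))" for x z
  have "open_weight w m (insert v V) a b n (insert {b, (v, i)} P)
      = (\<Sum>x\<in>{-1, 1}. \<Sum>y\<in>{-1, 1}. path_weight w m n x y * (\<Sum>z\<in>{-1, 1}. w (y * z) * m z * T x z))"
    unfolding open_weight_def sum_PiE_insert[OF assms(1,2)] verts weight T_def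
    by (intro sum.cong refl arg_cong2[of _ _ _ _ "(*)"]) (simp add: sum_distrib_left mult_ac)
  also have "\<dots> = (\<Sum>x\<in>{-1, 1}. \<Sum>z\<in>{-1, 1}. path_weight w m (Suc n) x z * T x z)"
    by (simp add: algebra_simps)
  also have "\<dots> = open_weight w m V a (v, 1 - i) (Suc n) P"
    by (simp only: open_weight_def T_def)
  finally show ?thesis .
qed

section \<open>Decomposition into cycles\<close>

lemma closed_weight_empty [simp]: "closed_weight w m {} {} = 1"
  by (simp add: closed_weight_def)

lemma pairings_two_half_edges_empty [simp]: "pairings (two_half_edges {}) = {{}}"
  by (simp add: two_half_edges_def pairings_empty)

lemma path_ends_Diff:
  assumes "a \<noteq> b" "a \<notin> two_half_edges V" "b \<notin> two_half_edges V"
  shows "insert a (insert b (two_half_edges V)) - {b, a} = two_half_edges V"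
    and "v \<in> V \<Longrightarrow> i < 2 \<Longrightarrow> insert a (insert b (two_half_edges V)) - {b, (v, i)}
      = insert a (insert (v, 1 - i) (two_half_edges (V - {v})))"
proof -
  show "insert a (insert b (two_half_edges V)) - {b, a} = two_half_edges V"
    using assms by auto
  have "1 - i \<noteq> i" if "i < 2" for i :: nat using that by presburger
  then show "v \<in> V \<Longrightarrow> i < 2 \<Longrightarrow> insert a (insert b (two_half_edges V)) - {b, (v, i)}
      = insert a (insert (v, 1 - i) (two_half_edges (V - {v})))"
    using assms by (auto simp: two_half_edges_def)
qed

lemma two_half_edges_Diff:
  "a \<notin> two_half_edges V \<Longrightarrow> a \<notin> two_half_edges (V - {v})"
  "(v, i) \<notin> two_half_edges (V - {v})"
  by (auto simp: two_half_edges_def)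

lemma two_half_edges_insert:
  "two_half_edges (insert v V) = insert (v, 0) (insert (v, 1) (two_half_edges V))"
  by (auto simp: two_half_edges_def less_2_cases_iff)

text \<open>
  The list \<open>ns\<close> has one entry \<open>L - 1\<close> for each cycle of length \<open>L\<close>. It is found before \<open>w\<close> and \<open>m\<close> are
  given: the same cycles compute the Ising weight for every field and count configurations. The
  induction on the number of unvisited vertices must treat closed and open states together, because
  starting a path turns a closed state into an open one with fewer vertices, and closing a path
  turns an open state into a closed one with the same vertices.
\<close>
lemma cycle_decomposition_open_closed:
  fixes V :: "'v set"
  assumes "finite V"
  shows "(\<forall>P\<in>pairings (two_half_edges V). \<exists>ns. sum_list (map Suc ns) = card V \<and>
      (\<forall>(w::real \<Rightarrow> 'f::field_char_0) m.
         closed_weight w m V P = prod_list (map (cycle_weight w m) ns))) \<and>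
    (\<forall>a b k. \<forall>P\<in>pairings (insert a (insert b (two_half_edges V))).
      a \<noteq> b \<longrightarrow> a \<notin> two_half_edges V \<longrightarrow> b \<notin> two_half_edges V \<longrightarrow>
      (\<exists>ns. sum_list (map Suc ns) = Suc k + card V \<and>
      (\<forall>(w::real \<Rightarrow> 'f::field_char_0) m.
         open_weight w m V a b k P = prod_list (map (cycle_weight w m) ns))))"
    (is "?closed V \<and> ?open V")
  using assms
proof (induction "card V" arbitrary: V)
  case 0
  then have V: "V = {}" by simp
  have closed: "?closed V"
    unfolding V by (auto intro!: exI[of _ "[]"])
  have "?open V"
  proof (intro allI ballI impI)
    fix a b :: "'v \<times> nat" and k P
    assume *: "P \<in> pairings (insert a (insert b (two_half_edges V)))" "a \<noteq> b"
      "a \<notin> two_half_edges V" "b \<notin> two_half_edges V"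
    obtain h P' where P': "h \<in> insert a (insert b (two_half_edges V)) - {b}" "P = insert {b, h} P'"
      "P' \<in> pairings (insert a (insert b (two_half_edges V)) - {b, h})"
      using *(1) by (rule pairingsE[of _ _ b]) auto
    then have "h = a" by (auto simp: V two_half_edges_def)
    then have "P' \<in> pairings (two_half_edges V)" "P = insert {a, b} P'"
      using P' path_ends_Diff(1)[OF *(2-4)] by (auto simp: insert_commute)
    then show "\<exists>ns. sum_list (map Suc ns) = Suc k + card V \<and>
      (\<forall>(w::real \<Rightarrow> 'f::field_char_0) m.
         open_weight w m V a b k P = prod_list (map (cycle_weight w m) ns))"
      using * by (intro exI[of _ "[k]"]) (auto simp: V open_weight_close)
  qed
  with closed show ?case by blast
next
  case (Suc n)
  have IH: "?closed (V - {v})" "?open (V - {v})" if "v \<in> V" for v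
    using Suc.hyps(1)[of "V - {v}"] Suc.hyps(2) Suc.prems that by simp_all
  have closed: "?closed V"
  proof
    fix P assume P: "P \<in> pairings (two_half_edges V)"
    obtain v where v: "v \<in> V" using Suc.hyps(2) by fastforce
    have ins: "insert v (V - {v}) = V" using v by auto
    have eq: "closed_weight w m V P = open_weight w m (V - {v}) (v, 0) (v, 1) 0 P"
      for w :: "real \<Rightarrow> 'f" and m
      using closed_weight_insert[of "V - {v}" v P w m] Suc.prems P unfolding ins by simp
    have "P \<in> pairings (insert (v, 0) (insert (v, 1) (two_half_edges (V - {v}))))"
      using P two_half_edges_insert[of v "V - {v}"] unfolding ins by simp
    then obtain ns where "sum_list (map Suc ns) = Suc 0 + card (V - {v})"
      "\<forall>(w::real \<Rightarrow> 'f::field_char_0) m.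
         open_weight w m (V - {v}) (v, 0) (v, 1) 0 P = prod_list (map (cycle_weight w m) ns)"
      using IH(2)[OF v, rule_format, of P "(v, 0)" "(v, 1)" 0] two_half_edges_Diff(2)[of v _ V]
      by auto
    then show "\<exists>ns. sum_list (map Suc ns) = card V \<and>
      (\<forall>(w::real \<Rightarrow> 'f::field_char_0) m.
         closed_weight w m V P = prod_list (map (cycle_weight w m) ns))"
      using v Suc.hyps(2) Suc.prems by (intro exI[of _ ns]) (simp add: eq card_gt_0_iff)
  qed
  have "?open V"
  proof (intro allI ballI impI)
    fix a b :: "'v \<times> nat" and k P
    assume *: "P \<in> pairings (insert a (insert b (two_half_edges V)))" "a \<noteq> b"
      "a \<notin> two_half_edges V" "b \<notin> two_half_edges V"
    obtain h P' where P': "h \<in> insert a (insert b (two_half_edges V)) - {b}" "P = insert {b, h} P'"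
      "P' \<in> pairings (insert a (insert b (two_half_edges V)) - {b, h})"
      using *(1) by (rule pairingsE[of _ _ b]) auto
    show "\<exists>ns. sum_list (map Suc ns) = Suc k + card V \<and>
      (\<forall>(w::real \<Rightarrow> 'f::field_char_0) m.
         open_weight w m V a b k P = prod_list (map (cycle_weight w m) ns))"
    proof (cases "h = a")
      case True
      then have PP: "P' \<in> pairings (two_half_edges V)" "P = insert {a, b} P'"
        using P' path_ends_Diff(1)[OF *(2-4)] by (auto simp: insert_commute)
      obtain ns where "sum_list (map Suc ns) = card V"
        "\<forall>(w::real \<Rightarrow> 'f::field_char_0) m.
         closed_weight w m V P' = prod_list (map (cycle_weight w m) ns)"
        using closed PP(1) by blast
      then show ?thesis
        using * PP Suc.prems by (intro exI[of _ "k # ns"]) (auto simp: open_weight_close)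
    next
      case False
      then obtain v i where h: "h = (v, i)" "v \<in> V" "i < 2"
        using P'(1) by (auto simp: two_half_edges_def)
      have ins: "insert v (V - {v}) = V" using h by auto
      have PP: "P' \<in> pairings (insert a (insert (v, 1 - i) (two_half_edges (V - {v}))))"
        using P'(3) path_ends_Diff(2)[OF *(2-4) h(2,3)] unfolding h(1) by simp
      have eq: "open_weight w m V a b k P = open_weight w m (V - {v}) a (v, 1 - i) (Suc k) P'"
        for w :: "real \<Rightarrow> 'f" and m
        using open_weight_extend[of "V - {v}" v i a b P' w m k] PP * h Suc.prems P'(2)
        unfolding ins by simp
      have a: "a \<noteq> (v, 1 - i)" using *(3) h by (auto simp: two_half_edges_def)
      obtain ns where "sum_list (map Suc ns) = Suc (Suc k) + card (V - {v})"
        "\<forall>(w::real \<Rightarrow> 'f::field_char_0) m.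
         open_weight w m (V - {v}) a (v, 1 - i) (Suc k) P' = prod_list (map (cycle_weight w m) ns)"
        using IH(2)[OF h(2), rule_format, OF PP a two_half_edges_Diff(1)[OF *(3)] two_half_edges_Diff(2)]
        by blast
      then show ?thesis
        using h Suc.hyps(2) Suc.prems by (intro exI[of _ ns]) (simp add: eq card_gt_0_iff)
    qed
  qed
  with closed show ?case by blast
qed

lemma cycle_decomposition:
  assumes "finite V" "P \<in> pairings (two_half_edges V)"
  obtains ns where "sum_list (map Suc ns) = card V"
    and "\<And>(w::real \<Rightarrow> 'f::field_char_0) m.
      closed_weight w m V P = prod_list (map (cycle_weight w m) ns)"
  using cycle_decomposition_open_closed[OF assms(1), where 'f='f] assms(2) by blast

section \<open>Sums over all pairings\<close>

text \<open>
  The coefficients of \<open>(1 - z) powr (- 1 / 2)\<close>, equal to \<open>(2 * n choose n) / 4 ^ n\<close>.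
\<close>
primrec inv_sqrt_coeff :: "nat \<Rightarrow> 'f::field_char_0" where
  "inv_sqrt_coeff 0 = 1"
| "inv_sqrt_coeff (Suc n) = inv_sqrt_coeff n * of_nat (2 * n + 1) / of_nat (2 * n + 2)"

text \<open>
  The coefficients of \<open>(1 - x * z) powr (- 1 / 2) * (1 - y * z) powr (- 1 / 2)\<close>.
\<close>
definition inv_sqrt_conv :: "'f::field_char_0 \<Rightarrow> 'f \<Rightarrow> nat \<Rightarrow> 'f" where
  "inv_sqrt_conv x y n
    = (\<Sum>k\<le>n. inv_sqrt_coeff k * inv_sqrt_coeff (n - k) * x ^ k * y ^ (n - k))"

lemma inv_sqrt_coeff_Suc:
  "of_nat (2 * Suc k) * inv_sqrt_coeff (Suc k) = (of_nat (2 * k + 1) * inv_sqrt_coeff k :: 'f::field_char_0)"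
proof -
  have "(of_nat (2 * k + 2) :: 'f) \<noteq> 0" by (simp only: of_nat_eq_0_iff)
  then show ?thesis by (simp del: of_nat_add of_nat_mult)
qed

lemma inv_sqrt_conv_commute: "inv_sqrt_conv x y n = inv_sqrt_conv y x n"
  unfolding inv_sqrt_conv_def
  by (rule sum.reindex_bij_witness[of _ "\<lambda>k. n - k" "\<lambda>k. n - k"]) auto

text \<open>
  This is the differential equation \<open>2 * g' = (x / (1 - x * z) + y / (1 - y * z)) * g\<close> of the
  generating function, read off coefficient by coefficient.
\<close>
lemma inv_sqrt_conv_Suc:
  fixes x y :: "'f::field_char_0"
  shows "of_nat (2 * Suc n) * inv_sqrt_conv x y (Suc n)
    = (\<Sum>j\<le>n. (x ^ Suc j + y ^ Suc j) * inv_sqrt_conv x y (n - j))"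
proof -
  \<comment> \<open>coefficients of the part of \<open>2 * z * g'\<close> in which the factor with \<open>x\<close> is differentiated\<close>
  define u where "u x y n
    = (\<Sum>k\<le>n. of_nat (2 * k) * inv_sqrt_coeff k * inv_sqrt_coeff (n - k) * x ^ k * y ^ (n - k))"
    for x y :: 'f and n
  have u_rec: "u x y (Suc n) = x * inv_sqrt_conv x y n + x * u x y n" for x y n
  proof -
    have "u x y (Suc n) = (\<Sum>k\<le>n. of_nat (2 * Suc k) * inv_sqrt_coeff (Suc k) *
        inv_sqrt_coeff (n - k) * x ^ Suc k * y ^ (n - k))"
      unfolding u_def by (subst sum.atMost_Suc_shift) simp
    also have "\<dots> = (\<Sum>k\<le>n. x * (inv_sqrt_coeff k * inv_sqrt_coeff (n - k) * x ^ k * y ^ (n - k))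
       + x * (of_nat (2 * k) * inv_sqrt_coeff k * inv_sqrt_coeff (n - k) * x ^ k * y ^ (n - k)))"
      unfolding inv_sqrt_coeff_Suc by (simp add: algebra_simps)
    finally show ?thesis
      by (simp add: inv_sqrt_conv_def u_def sum.distrib sum_distrib_left)
  qed
  have u_sum: "u x y (Suc n) = (\<Sum>j\<le>n. x ^ Suc j * inv_sqrt_conv x y (n - j))" for x y n
  proof (induction n)
    case 0
    show ?case by (simp add: u_rec) (simp add: u_def)
  next
    case (Suc n)
    show ?case
      by (subst u_rec, subst Suc.IH, subst sum.atMost_Suc_shift)
         (simp add: sum_distrib_left mult.assoc)
  qed
  have "u y x (Suc n) = (\<Sum>k\<le>Suc n. of_nat (2 * (Suc n - k)) * inv_sqrt_coeff (Suc n - k) *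
      inv_sqrt_coeff k * y ^ (Suc n - k) * x ^ k)"
    unfolding u_def
    by (rule sum.reindex_bij_witness[of _ "\<lambda>k. Suc n - k" "\<lambda>k. Suc n - k"]) auto
  then have "u x y (Suc n) + u y x (Suc n) = (\<Sum>k\<le>Suc n. (of_nat (2 * k) + of_nat (2 * (Suc n - k)))
      * (inv_sqrt_coeff k * inv_sqrt_coeff (Suc n - k) * x ^ k * y ^ (Suc n - k)))"
    by (simp only: u_def sum.distrib[symmetric]) (intro sum.cong refl, simp only: algebra_simps)
  also have "\<dots> = of_nat (2 * Suc n) * inv_sqrt_conv x y (Suc n)"
    unfolding inv_sqrt_conv_def sum_distrib_left of_nat_add[symmetric]
    by (intro sum.cong refl arg_cong2[of _ _ _ _ "(*)"] arg_cong[of _ _ of_nat]) auto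
  finally show ?thesis
    by (simp only: u_sum inv_sqrt_conv_commute[of y x] distrib_right sum.distrib)
qed

text \<open>
  The half-edge \<open>b\<close> is paired either with the other end \<open>a\<close> of the path, which closes the cycle, or with
  one of the two half-edges of an unvisited vertex.
\<close>
lemma sum_open_weight:
  assumes V: "finite V" and ab: "a \<noteq> b" "a \<notin> two_half_edges V" "b \<notin> two_half_edges V"
  shows "(\<Sum>P\<in>pairings (insert a (insert b (two_half_edges V))). open_weight w m V a b k P)
    = cycle_weight w m k * (\<Sum>P\<in>pairings (two_half_edges V). closed_weight w m V P)
    + (\<Sum>v\<in>V. \<Sum>i<2. \<Sum>P\<in>pairings (insert a (insert (v, 1 - i) (two_half_edges (V - {v})))).
         open_weight w m (V - {v}) a (v, 1 - i) (Suc k) P)"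
    (is "?L = ?R1 + ?R2")
proof -
  let ?H = "insert a (insert b (two_half_edges V))"
  define f where "f h = (\<Sum>P\<in>pairings (?H - {b, h}). open_weight w m V a b k (insert {b, h} P))" for h
  have "?L = (\<Sum>h\<in>?H - {b}. f h)"
    unfolding f_def using V by (intro sum_pairings) auto
  also have "?H - {b} = insert a (two_half_edges V)"
    using ab by auto
  also have "(\<Sum>h\<in>insert a (two_half_edges V). f h) = f a + (\<Sum>h\<in>two_half_edges V. f h)"
    using ab V by simp
  also have "f a = ?R1"
    unfolding f_def path_ends_Diff(1)[OF ab] sum_distrib_left
    using V ab by (intro sum.cong refl) (simp add: open_weight_close insert_commute[of b a])
  also have "(\<Sum>h\<in>two_half_edges V. f h) = (\<Sum>v\<in>V. \<Sum>i<2. f (v, i))"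
    by (simp add: two_half_edges_def sum.cartesian_product)
  also have "\<dots> = ?R2"
  proof (intro sum.cong refl)
    fix v and i :: nat assume v: "v \<in> V" and i: "i \<in> {..<2}"
    have ins: "insert v (V - {v}) = V" using v by auto
    have "open_weight w m V a b k (insert {b, (v, i)} P)
        = open_weight w m (V - {v}) a (v, 1 - i) (Suc k) P"
      if "P \<in> pairings (insert a (insert (v, 1 - i) (two_half_edges (V - {v}))))" for P
      using open_weight_extend[of "V - {v}" v i a b P w m k] that V ab i unfolding ins by simp
    then show "f (v, i) = (\<Sum>P\<in>pairings (insert a (insert (v, 1 - i) (two_half_edges (V - {v})))).
         open_weight w m (V - {v}) a (v, 1 - i) (Suc k) P)"
      using i unfolding f_def by (subst path_ends_Diff(2)[OF ab v]) auto
  qed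
  finally show ?thesis .
qed

text \<open>
  A closed state with \<open>Suc n\<close> vertices is an open state with a path of one vertex and \<open>n\<close> unvisited
  vertices. The resulting sum over the length of the cycle is the right-hand side of
  \<open>inv_sqrt_conv_Suc\<close>, which closes the induction.
\<close>
lemma sum_open_closed_weight:
  fixes V :: "'v set"
  assumes "finite V"
    and eig: "\<And>n. cycle_weight w m n = x ^ Suc n + y ^ Suc n"
  shows "(\<Sum>P\<in>pairings (two_half_edges V). closed_weight w m V P)
      = 2 ^ card V * fact (card V) * inv_sqrt_conv x y (card V) \<and>
    (\<forall>a b k. a \<noteq> b \<longrightarrow> a \<notin> two_half_edges V \<longrightarrow> b \<notin> two_half_edges V \<longrightarrow>
     (\<Sum>P\<in>pairings (insert a (insert b (two_half_edges V))). open_weight w m V a b k P)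
      = 2 ^ card V * fact (card V) *
        (\<Sum>j\<le>card V. cycle_weight w m (k + j) * inv_sqrt_conv x y (card V - j)))"
    (is "?closed V \<and> ?open V")
  using assms(1)
proof (induction "card V" arbitrary: V)
  case 0
  then have V: "V = {}" by simp
  have closed: "?closed V"
    by (simp add: V inv_sqrt_conv_def)
  have "?open V"
    by (auto simp: sum_open_weight V inv_sqrt_conv_def)
  with closed show ?case by blast
next
  case (Suc n)
  have card: "card V = Suc n" using Suc by simp
  have IH: "?open (V - {v})" if "v \<in> V" for v
    using Suc.hyps(1)[of "V - {v}"] Suc.hyps(2) Suc.prems that by simp
  have closed: "?closed V"
  proof -
    obtain v where v: "v \<in> V" using card by fastforce
    have ins: "insert v (V - {v}) = V" using v by auto
    have cv: "card (V - {v}) = n" using v card Suc.prems by simp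
    have "(\<Sum>P\<in>pairings (two_half_edges V). closed_weight w m V P)
      = (\<Sum>P\<in>pairings (two_half_edges V). open_weight w m (V - {v}) (v, 0) (v, 1) 0 P)"
      using closed_weight_insert[of "V - {v}" v _ w m] Suc.prems unfolding ins by simp
    also have "\<dots> = 2 ^ n * fact n *
        (\<Sum>j\<le>n. cycle_weight w m (0 + j) * inv_sqrt_conv x y (n - j))"
      using IH[OF v, rule_format, of "(v, 0)" "(v, 1)" 0] two_half_edges_insert[of v "V - {v}"]
      unfolding ins cv by (simp add: two_half_edges_Diff)
    also have "\<dots> = 2 ^ n * fact n * (of_nat (2 * Suc n) * inv_sqrt_conv x y (Suc n))"
      unfolding inv_sqrt_conv_Suc by (simp add: eig)
    finally show ?thesis
      unfolding card by (simp add: algebra_simps)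
  qed
  have "?open V"
  proof (intro allI impI)
    fix a b :: "'v \<times> nat" and k
    assume ab: "a \<noteq> b" "a \<notin> two_half_edges V" "b \<notin> two_half_edges V"
    have "(\<Sum>P\<in>pairings (insert a (insert (v, 1 - i) (two_half_edges (V - {v})))).
         open_weight w m (V - {v}) a (v, 1 - i) (Suc k) P)
      = 2 ^ n * fact n * (\<Sum>j\<le>n. cycle_weight w m (Suc k + j) * inv_sqrt_conv x y (n - j))"
      if v: "v \<in> V" and i: "i < 2" for v and i :: nat
    proof -
      have a: "a \<noteq> (v, 1 - i)" using ab(2) v by (auto simp: two_half_edges_def)
      have cv: "card (V - {v}) = n" using v card Suc.prems by simp
      show ?thesis
        using IH[OF v, rule_format, OF a two_half_edges_Diff(1)[OF ab(2)] two_half_edges_Diff(2)]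
        unfolding cv .
    qed
    then have "(\<Sum>P\<in>pairings (insert a (insert b (two_half_edges V))). open_weight w m V a b k P)
      = cycle_weight w m k * (2 ^ Suc n * fact (Suc n) * inv_sqrt_conv x y (Suc n))
      + of_nat (2 * Suc n) *
        (2 ^ n * fact n * (\<Sum>j\<le>n. cycle_weight w m (Suc k + j) * inv_sqrt_conv x y (n - j)))"
      using closed Suc.prems unfolding sum_open_weight[OF Suc.prems ab] card by (simp add: card)
    also have "\<dots> = 2 ^ Suc n * fact (Suc n) *
        (cycle_weight w m k * inv_sqrt_conv x y (Suc n) +
         (\<Sum>j\<le>n. cycle_weight w m (Suc k + j) * inv_sqrt_conv x y (n - j)))"
      by (simp add: algebra_simps)
    also have "\<dots> = 2 ^ Suc n * fact (Suc n) *
        (\<Sum>j\<le>Suc n. cycle_weight w m (k + j) * inv_sqrt_conv x y (Suc n - j))"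
      by (subst sum.atMost_Suc_shift) simp
    finally show "(\<Sum>P\<in>pairings (insert a (insert b (two_half_edges V))). open_weight w m V a b k P)
      = 2 ^ card V * fact (card V) *
        (\<Sum>j\<le>card V. cycle_weight w m (k + j) * inv_sqrt_conv x y (card V - j))"
      unfolding card .
  qed
  with closed show ?case by blast
qed

lemma sum_closed_weight:
  assumes "finite V" "x + y = w 1 * (m 1 + m (- 1))"
    and "x * y = m 1 * m (- 1) * ((w 1)\<^sup>2 - (w (- 1))\<^sup>2)"
  shows "(\<Sum>P\<in>pairings (two_half_edges V). closed_weight w m V P)
      = 2 ^ card V * fact (card V) * inv_sqrt_conv x y (card V)"
  using sum_open_closed_weight[OF assms(1) cycle_weight_eigenvalues[OF assms(2,3)]] by blast

section \<open>The cycle correction of the annealed partition function\<close>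

lemma half_edges_two: "half_edges N (\<lambda>_. 2) = two_half_edges {1..N}"
  by (simp add: half_edges_def two_half_edges_def)

lemma finite_pairings_two_half_edges [simp]: "finite V \<Longrightarrow> finite (pairings (two_half_edges V))"
  by (simp add: finite_pairings)

lemma pairings_two_half_edges_nonempty: "finite V \<Longrightarrow> pairings (two_half_edges V) \<noteq> {}"
  by (rule pairings_nonempty) (auto simp: two_half_edges_def)

lemma inv_sqrt_conv_right_zero: "inv_sqrt_conv x 0 n = inv_sqrt_coeff n * x ^ n"
proof -
  have "inv_sqrt_conv x 0 n
    = (\<Sum>k\<le>n. if k = n then inv_sqrt_coeff k * inv_sqrt_coeff (n - k) * x ^ k else 0)"
    unfolding inv_sqrt_conv_def by (intro sum.cong refl) auto
  then show ?thesis by simp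
qed

text \<open>
  With \<open>w = 1\<close> and \<open>m = 1 / 2\<close> every pairing has weight 1, and the transfer matrix has the
  eigenvalues 1 and 0. The value is \<open>(2 * card V - 1)!!\<close>.
\<close>
lemma card_pairings_two_half_edges:
  assumes "finite V"
  shows "(of_nat (card (pairings (two_half_edges V))) :: 'f::field_char_0)
    = 2 ^ card V * fact (card V) * inv_sqrt_coeff (card V)"
proof -
  have "closed_weight (\<lambda>_. 1) (\<lambda>_. 1 / 2 :: 'f) V P = 1" for P :: "('a \<times> nat) set set"
    using assms by (simp add: closed_weight_def card_PiE power_one_over)
  then have "(of_nat (card (pairings (two_half_edges V))) :: 'f)
    = (\<Sum>P\<in>pairings (two_half_edges V). closed_weight (\<lambda>_. 1) (\<lambda>_. 1 / 2) V P)"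
    by simp
  also have "\<dots> = 2 ^ card V * fact (card V) * inv_sqrt_conv 1 0 (card V)"
    using assms by (intro sum_closed_weight) auto
  finally show ?thesis by (simp add: inv_sqrt_conv_right_zero)
qed

lemma inv_sqrt_coeff_pos [simp]: "(0::real) < inv_sqrt_coeff n"
  by (induction n) (auto intro!: divide_pos_pos mult_pos_pos)

lemma of_real_inv_sqrt_coeff:
  "(of_real (inv_sqrt_coeff n) :: 'f::real_field) = inv_sqrt_coeff n"
  by (induction n) auto

lemma inv_sqrt_coeff_lower: "n \<ge> 1 \<Longrightarrow> 1 / (2 * real n) \<le> inv_sqrt_coeff n"
proof (induction n rule: nat_induct_at_least)
  case base
  show ?case by simp
next
  case (Suc n)
  have "1 / (2 * real (Suc n)) = 1 / (2 * real n) * (2 * real n) / (2 * real n + 2)"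
    using Suc.hyps by (simp add: field_simps)
  also have "\<dots> \<le> inv_sqrt_coeff n * (2 * real n + 1) / (2 * real n + 2)"
    using Suc by (intro divide_right_mono mult_mono) (auto intro: less_imp_le)
  finally show ?case by (simp add: algebra_simps)
qed

text \<open>
  Both sides are products of \<open>a + b\<close> factors \<open>(2 * k + 1) / (2 * k + 2)\<close>, and these increase with \<open>k\<close>.
\<close>
lemma inv_sqrt_coeff_mult_le: "inv_sqrt_coeff a * inv_sqrt_coeff b \<le> (inv_sqrt_coeff (a + b) :: real)"
proof (induction a)
  case (Suc a)
  have "inv_sqrt_coeff (Suc a) * inv_sqrt_coeff b
      = (inv_sqrt_coeff a * inv_sqrt_coeff b) * ((2 * real a + 1) / (2 * real a + 2))"
    by (simp add: algebra_simps)
  also have "\<dots> \<le> inv_sqrt_coeff (a + b) * ((2 * real (a + b) + 1) / (2 * real (a + b) + 2))"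
  proof (intro mult_mono Suc.IH)
    show "(2 * real a + 1) / (2 * real a + 2) \<le> (2 * real (a + b) + 1) / (2 * real (a + b) + 2)"
      by (simp add: field_simps)
  qed (auto intro: less_imp_le)
  also have "\<dots> = inv_sqrt_coeff (Suc a + b)"
    by (simp add: algebra_simps)
  finally show ?case .
qed auto

lemma inv_sqrt_coeff_le_1: "inv_sqrt_coeff n \<le> (1::real)"
  by (induction n) (auto simp: divide_le_eq intro!: mult_mono[of _ 1 "1 + 2 * real _" "2 + 2 * real _", simplified])

lemma inv_sqrt_coeff_ratio_lim:
  "(\<lambda>n. inv_sqrt_coeff (n - k) / inv_sqrt_coeff n :: real) \<longlonglongrightarrow> 1"
proof -
  have "(\<lambda>n. inv_sqrt_coeff n / inv_sqrt_coeff (n + k) :: real) \<longlonglongrightarrow> 1"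
  proof (induction k)
    case 0
    show ?case by (simp add: less_imp_neq[OF inv_sqrt_coeff_pos, symmetric])
  next
    case (Suc k)
    have "(\<lambda>n. (2 * real (n + k) + 2) / (2 * real (n + k) + 1)) \<longlonglongrightarrow> 1"
      by real_asymp
    from tendsto_mult[OF Suc this]
    have "(\<lambda>n. inv_sqrt_coeff n / inv_sqrt_coeff (n + k)
        * ((2 * real (n + k) + 2) / (2 * real (n + k) + 1))) \<longlonglongrightarrow> 1"
      by simp
    also have "(\<lambda>n. inv_sqrt_coeff n / inv_sqrt_coeff (n + k)
        * ((2 * real (n + k) + 2) / (2 * real (n + k) + 1)))
      = (\<lambda>n. inv_sqrt_coeff n / inv_sqrt_coeff (n + Suc k))"
      by (rule ext) (simp add: mult_ac add_ac)
    finally show ?case .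
  qed
  then have "(\<lambda>n. inv_sqrt_coeff (n + k - k) / inv_sqrt_coeff (n + k) :: real) \<longlonglongrightarrow> 1"
    by simp
  then show ?thesis
    by (rule LIMSEQ_offset)
qed

text \<open>
  The polynomial \<open>cycle_series N q\<close> is the expectation, over a uniform pairing, of the product of
  \<open>1 + q ^ L\<close> over the lengths \<open>L\<close> of the cycles.
\<close>
definition cycle_coeff :: "nat \<Rightarrow> nat \<Rightarrow> real" where
  "cycle_coeff N k = inv_sqrt_coeff k * inv_sqrt_coeff (N - k) / inv_sqrt_coeff N"

definition cycle_series :: "nat \<Rightarrow> 'f::real_field \<Rightarrow> 'f" where
  "cycle_series N q = (\<Sum>k\<le>N. of_real (cycle_coeff N k) * q ^ k)"

lemma cycle_coeff_nonneg: "0 \<le> cycle_coeff N k"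
  by (simp add: cycle_coeff_def less_imp_le)

lemma cycle_coeff_le_1: "k \<le> N \<Longrightarrow> cycle_coeff N k \<le> 1"
  using inv_sqrt_coeff_mult_le[of k "N - k"] by (simp add: cycle_coeff_def)

lemma cycle_coeff_0 [simp]: "cycle_coeff N 0 = 1"
  by (simp add: cycle_coeff_def less_imp_neq[OF inv_sqrt_coeff_pos, symmetric])

lemma inv_sqrt_conv_ratio:
  "inv_sqrt_conv x (q * x) N / inv_sqrt_coeff N = (x ^ N * cycle_series N q :: 'f::real_field)"
proof -
  have "inv_sqrt_conv x (q * x) N / inv_sqrt_coeff N = inv_sqrt_conv (q * x) x N / inv_sqrt_coeff N"
    by (simp only: inv_sqrt_conv_commute)
  also have "\<dots> = x ^ N * cycle_series N q"
    unfolding inv_sqrt_conv_def cycle_series_def cycle_coeff_def sum_divide_distrib sum_distrib_left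
    by (intro sum.cong refl)
       (simp add: of_real_inv_sqrt_coeff power_mult_distrib power_add[symmetric] mult_ac
          flip: power_add)
  finally show ?thesis .
qed

lemma cycle_series_ge_1: "0 \<le> q \<Longrightarrow> (1::real) \<le> cycle_series N q"
  unfolding cycle_series_def
  by (rule order_trans[OF _ member_le_sum[of 0]]) (auto simp: cycle_coeff_nonneg)

text \<open>
  Tannery's theorem applies because the coefficients are at most 1 and converge one by one. The
  argument \<open>Q N\<close> may move with \<open>N\<close>, as it does when the magnetic field is perturbed by a term of
  order \<open>1 / sqrt N\<close>.
\<close>
lemma cycle_series_lim:
  fixes q :: "'f::{real_normed_field,banach}"
  assumes "Q \<longlonglongrightarrow> q" "norm q < 1"
  shows "(\<lambda>N. cycle_series N (Q N)) \<longlonglongrightarrow> (\<Sum>k. of_real (inv_sqrt_coeff k) * q ^ k)"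
proof -
  obtain \<rho> where \<rho>: "norm q < \<rho>" "\<rho> < 1" using assms(2) dense by blast
  have \<rho>0: "0 \<le> \<rho>" using \<rho>(1) norm_ge_zero order.strict_trans1 less_imp_le by blast
  define f where "f k N = (if k \<le> N then of_real (cycle_coeff N k) * Q N ^ k else 0)" for k N
  have ev: "\<forall>\<^sub>F N in sequentially. norm (Q N) < \<rho>"
    using tendsto_norm[OF assms(1)] \<rho>(1) by (rule order_tendstoD)
  have bound: "norm (f k N) \<le> \<rho> ^ k" if "norm (Q N) < \<rho>" for k N
  proof (cases "k \<le> N")
    case True
    have "norm (f k N) = cycle_coeff N k * norm (Q N) ^ k"
      using True by (simp add: f_def norm_mult norm_power cycle_coeff_nonneg)
    also have "\<dots> \<le> 1 * \<rho> ^ k"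
      using that True by (intro mult_mono power_mono cycle_coeff_le_1) auto
    finally show ?thesis by simp
  qed (use \<rho>0 in \<open>simp add: f_def\<close>)
  have lim: "(f k \<longlongrightarrow> of_real (inv_sqrt_coeff k) * q ^ k) sequentially" for k
  proof -
    have "(\<lambda>N. inv_sqrt_coeff k * (inv_sqrt_coeff (N - k) / inv_sqrt_coeff N)) \<longlonglongrightarrow> inv_sqrt_coeff k * (1::real)"
      by (intro tendsto_intros inv_sqrt_coeff_ratio_lim)
    then have "(\<lambda>N. cycle_coeff N k) \<longlonglongrightarrow> inv_sqrt_coeff k"
      by (simp add: cycle_coeff_def)
    then have "(\<lambda>N. of_real (cycle_coeff N k) * Q N ^ k) \<longlonglongrightarrow> of_real (inv_sqrt_coeff k) * q ^ k"
      by (intro tendsto_intros assms)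
    then show ?thesis
      by (rule Lim_transform_eventually)
         (rule eventually_mono[OF eventually_ge_at_top[of k]], simp add: f_def)
  qed
  have "((\<lambda>N. \<Sum>k. f k N) \<longlongrightarrow> (\<Sum>k. of_real (inv_sqrt_coeff k) * q ^ k)) sequentially"
  proof (rule conjunct2[OF conjunct2[OF tannerys_theorem[OF lim _ _]]])
    show "\<forall>\<^sub>F (k, N) in at_top \<times>\<^sub>F sequentially. norm (f k N) \<le> \<rho> ^ k"
      unfolding eventually_prod_filter
      by (rule exI[of _ "\<lambda>_. True"], rule exI[of _ "\<lambda>N. norm (Q N) < \<rho>"]) (use ev bound in auto)
    show "summable (\<lambda>k. \<rho> ^ k)"
      using \<rho> \<rho>0 by (intro summable_geometric) auto
  qed auto
  also have "(\<lambda>N. \<Sum>k. f k N) = (\<lambda>N. cycle_series N (Q N))"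
  proof
    fix N
    have "(\<Sum>k. f k N) = (\<Sum>k\<le>N. f k N)"
      by (rule suminf_finite) (auto simp: f_def)
    then show "(\<Sum>k. f k N) = cycle_series N (Q N)"
      by (simp add: cycle_series_def f_def)
  qed
  finally show ?thesis .
qed

lemma cycle_limit_pos:
  assumes "0 \<le> q" "q < (1::real)"
  shows "0 < (\<Sum>k. inv_sqrt_coeff k * q ^ k)"
proof -
  have "summable (\<lambda>k. inv_sqrt_coeff k * q ^ k)"
    by (rule summable_comparison_test[OF _ summable_geometric[of q]])
       (use assms in \<open>auto intro!: exI[of _ 0] mult_left_le_one_le
          simp: inv_sqrt_coeff_le_1 abs_mult less_imp_le power_abs\<close>)
  then show ?thesis
    using assms by (intro suminf_pos2[of _ 0]) (auto simp: less_imp_le)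
qed

section \<open>Boltzmann weights of the configuration model\<close>

lemma sum_edges_multigraph_of:
  "(\<Sum>e\<in>#multigraph_of P. F (\<Prod>i\<in>#e. \<sigma> i)) = (\<Sum>e\<in>P. F (\<Prod>h\<in>e. \<sigma> (fst h)))"
  by (simp add: multigraph_of_def image_mset.compositionality o_def sum_unfold_sum_mset
      prod_unfold_prod_mset)

lemma prod_edges_multigraph_of:
  "(\<Prod>e\<in>#multigraph_of P. F (\<Prod>i\<in>#e. \<sigma> i)) = (\<Prod>e\<in>P. F (\<Prod>h\<in>e. \<sigma> (fst h)))"
  by (simp add: multigraph_of_def image_mset.compositionality o_def
      prod_unfold_prod_mset)

text \<open>
  The factor \<open>exp (z * S)\<close>, with \<open>S\<close> the total spin, shifts the magnetic field from \<open>B\<close> to \<open>B + z\<close>. This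
  turns moment generating functions and, for imaginary \<open>z\<close>, characteristic functions into partition
  functions.
\<close>
lemma boltzmann_weight_tilted:
  fixes z :: "'f::{real_normed_field,banach}"
  assumes "finite P"
  shows "of_real (boltzmann_weight N \<beta> B (multigraph_of P) \<sigma>) * exp (z * of_real (total_spin N \<sigma>))
    = (\<Prod>v\<in>{1..N}. exp ((of_real B + z) * of_real (\<sigma> v))) *
      (\<Prod>e\<in>P. of_real (exp (\<beta> * (\<Prod>h\<in>e. \<sigma> (fst h)))))"
proof -
  have "of_real (boltzmann_weight N \<beta> B (multigraph_of P) \<sigma>) * exp (z * of_real (total_spin N \<sigma>))
    = exp ((of_real B + z) * of_real (total_spin N \<sigma>)) *
      of_real (exp (\<beta> * (\<Sum>e\<in>P. \<Prod>h\<in>e. \<sigma> (fst h))))"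
    using sum_edges_multigraph_of[of "\<lambda>x. x" \<sigma> P]
    by (simp add: boltzmann_weight_def total_spin_def exp_add exp_of_real[symmetric] algebra_simps)
  also have "exp ((of_real B + z) * of_real (total_spin N \<sigma>))
      = (\<Prod>v\<in>{1..N}. exp ((of_real B + z) * of_real (\<sigma> v)))"
    by (simp add: total_spin_def sum_distrib_left exp_sum)
  also have "exp (\<beta> * (\<Sum>e\<in>P. \<Prod>h\<in>e. \<sigma> (fst h))) = (\<Prod>e\<in>P. exp (\<beta> * (\<Prod>h\<in>e. \<sigma> (fst h))))"
    using assms by (simp add: sum_distrib_left exp_sum)
  finally show ?thesis by simp
qed

lemma sum_boltzmann_weight_tilted:
  fixes z :: "'f::{real_normed_field,banach}"
  assumes "finite P"
  shows "(\<Sum>\<sigma>\<in>spin_configs N. of_real (boltzmann_weight N \<beta> B (multigraph_of P) \<sigma>)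
      * exp (z * of_real (total_spin N \<sigma>)))
    = closed_weight (\<lambda>u. of_real (exp (\<beta> * u))) (\<lambda>u. exp ((of_real B + z) * of_real u)) {1..N} P"
  unfolding closed_weight_def spin_configs_def boltzmann_weight_tilted[OF assms] ..

lemma expectation_CM_two:
  fixes F :: "multigraph \<Rightarrow> real"
  shows "measure_pmf.expectation (CM N (\<lambda>_. 2)) F
    = (\<Sum>P\<in>pairings (two_half_edges {1..N}). F (multigraph_of P))
      / card (pairings (two_half_edges {1..N}))"
  unfolding CM_def half_edges_two integral_map_pmf
  by (subst integral_pmf_of_set) (auto simp: pairings_two_half_edges_nonempty)

lemma annealed_tilted:
  fixes x q z :: "'f::{real_normed_field,banach}"
  assumes "x + q * x = of_real (exp \<beta>) * (exp (of_real B + z) + exp (- (of_real B + z)))"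
    and "x * (q * x) = of_real ((exp \<beta>)\<^sup>2 - (exp (- \<beta>))\<^sup>2)"
  shows "(\<Sum>\<sigma>\<in>spin_configs N.
      of_real (measure_pmf.expectation (CM N (\<lambda>_. 2)) (\<lambda>E. boltzmann_weight N \<beta> B E \<sigma>))
      * exp (z * of_real (total_spin N \<sigma>))) = x ^ N * cycle_series N q"
proof -
  let ?PP = "pairings (two_half_edges {1..N})"
  let ?b = "of_real B + z"
  have "(\<Sum>\<sigma>\<in>spin_configs N.
      of_real (measure_pmf.expectation (CM N (\<lambda>_. 2)) (\<lambda>E. boltzmann_weight N \<beta> B E \<sigma>))
      * exp (z * of_real (total_spin N \<sigma>)))
    = (\<Sum>\<sigma>\<in>spin_configs N. \<Sum>P\<in>?PP. of_real (boltzmann_weight N \<beta> B (multigraph_of P) \<sigma>)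
      * exp (z * of_real (total_spin N \<sigma>))) / of_nat (card ?PP)"
    by (simp add: expectation_CM_two sum_divide_distrib sum_distrib_right)
  also have "\<dots> = (\<Sum>P\<in>?PP. \<Sum>\<sigma>\<in>spin_configs N. of_real (boltzmann_weight N \<beta> B (multigraph_of P) \<sigma>)
      * exp (z * of_real (total_spin N \<sigma>))) / of_nat (card ?PP)"
    by (subst sum.swap) simp
  also have "\<dots> = (\<Sum>P\<in>?PP. closed_weight (\<lambda>u. of_real (exp (\<beta> * u))) (\<lambda>u. exp (?b * of_real u)) {1..N} P)
      / of_nat (card ?PP)"
    by (intro arg_cong2[of _ _ _ _ "(/)"] sum.cong refl sum_boltzmann_weight_tilted)
       (auto intro: finite_pairing[OF finite_two_half_edges])
  also have "\<dots> = inv_sqrt_conv x (q * x) N / inv_sqrt_coeff N"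
    using assms
    by (subst sum_closed_weight[of _ x "q * x"])
       (simp_all add: card_pairings_two_half_edges exp_add[symmetric] algebra_simps)
  also have "\<dots> = x ^ N * cycle_series N q"
    by (rule inv_sqrt_conv_ratio)
  finally show ?thesis .
qed

section \<open>The number of cycles\<close>

text \<open>
  The number of spin configurations that are constant along every edge. A connected component
  has two of them, so this is \<open>2 ^ K\<close> for a graph with \<open>K\<close> cycles. It is given as a function of the
  multigraph so that it is a random variable on the probability space of the graph, and it is a
  weight of the form treated above.
\<close>
definition coherent_configs :: "nat \<Rightarrow> multigraph \<Rightarrow> real" where
  "coherent_configs N E = (\<Sum>\<sigma>\<in>spin_configs N. \<Prod>e\<in>#E. (1 + (\<Prod>i\<in>#e. \<sigma> i)) / 2)"

lemma coherent_configs_multigraph_of: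
  "coherent_configs N (multigraph_of P) = closed_weight (\<lambda>u. (1 + u) / 2) (\<lambda>_. 1) {1..N} P"
  unfolding coherent_configs_def closed_weight_def spin_configs_def
  using prod_edges_multigraph_of[of "\<lambda>u. (1 + u) / 2 :: real"] by simp

lemma inv_sqrt_conv_1_1: "inv_sqrt_conv 1 1 n = (1 :: 'f::field_char_0)"
proof (induction n rule: less_induct)
  case (less n)
  show ?case
  proof (cases n)
    case (Suc m)
    have "(\<Sum>j\<le>m. (1 ^ Suc j + 1 ^ Suc j) * inv_sqrt_conv 1 1 (m - j)) = (\<Sum>j\<le>m. (2::'f))"
      using less by (intro sum.cong refl) (simp add: Suc)
    then have "of_nat (2 * Suc m) * inv_sqrt_conv 1 1 (Suc m) = (of_nat (2 * Suc m) :: 'f)"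
      unfolding inv_sqrt_conv_Suc by simp
    then show ?thesis
      unfolding Suc using of_nat_eq_0_iff[of "2 * Suc m", where 'a='f]
      by (metis mult_cancel_left1 nat.simps(3) no_zero_divisors zero_neq_numeral)
  qed (simp add: inv_sqrt_conv_def)
qed

text \<open>
  The transfer matrix is the identity here, so both eigenvalues are 1 and the sum over pairings is
  governed by \<open>inv_sqrt_conv 1 1 N\<close>, a coefficient of \<open>1 / (1 - z)\<close>.
\<close>
lemma expectation_coherent_configs:
  "measure_pmf.expectation (CM N (\<lambda>_. 2)) (coherent_configs N) = 1 / inv_sqrt_coeff N"
proof -
  have "(\<Sum>P\<in>pairings (two_half_edges {1..N}). coherent_configs N (multigraph_of P))
     = 2 ^ N * fact N * inv_sqrt_conv 1 1 N"
    unfolding coherent_configs_multigraph_of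
    by (subst sum_closed_weight[of _ 1 1]) auto
  then show ?thesis
    by (simp add: expectation_CM_two card_pairings_two_half_edges inv_sqrt_conv_1_1)
qed

lemma coherent_configs_cycles:
  assumes "\<And>(w :: real \<Rightarrow> real) m. closed_weight w m {1..N} P = prod_list (map (cycle_weight w m) ns)"
  shows "coherent_configs N (multigraph_of P) = 2 ^ length ns"
proof -
  have "cycle_weight (\<lambda>u. (1 + u) / 2) (\<lambda>_. 1) n = (2::real)" for n
    by (subst cycle_weight_eigenvalues[of 1 1]) auto
  then have "prod_list (map (cycle_weight (\<lambda>u. (1 + u) / 2) (\<lambda>_. 1)) ns) = (2::real) ^ length ns"
    for ns
    by (induction ns) auto
  then show ?thesis
    unfolding coherent_configs_multigraph_of assms .
qed

section \<open>The eigenvalues of the one-dimensional transfer matrix\<close>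

text \<open>
  With \<open>S b\<close> a square root of \<open>(sinh b)\<^sup>2 + \<kappa>\<close>, one eigenvalue is \<open>exp \<beta>\<close> times \<open>cosh b + S b\<close>,
  where \<open>\<kappa> = exp (- 4 * \<beta>)\<close>. The next three lemmas use only the equation and the derivative of the
  square root, so they apply both to real fields and, later, to complex ones.
\<close>
lemma DERIV_cosh_plus_root:
  fixes S :: "'f::{real_normed_field,banach} \<Rightarrow> 'f"
  assumes "(S has_field_derivative sinh b * cosh b / S b) (at b)" "S b \<noteq> 0"
  shows "((\<lambda>b. cosh b + S b) has_field_derivative (cosh b + S b) * (sinh b / S b)) (at b)"
proof -
  have "((\<lambda>b. cosh b + S b) has_field_derivative sinh b + sinh b * cosh b / S b) (at b)"
    by (rule derivative_eq_intros assms refl | simp)+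
  also have "sinh b + sinh b * cosh b / S b = (cosh b + S b) * (sinh b / S b)"
    using assms(2) by (simp add: field_simps)
  finally show ?thesis .
qed

lemma DERIV_sinh_div_root:
  fixes S :: "'f::{real_normed_field,banach} \<Rightarrow> 'f"
  assumes "(S has_field_derivative sinh b * cosh b / S b) (at b)" "S b \<noteq> 0"
    and "(S b)\<^sup>2 = (sinh b)\<^sup>2 + \<kappa>"
  shows "((\<lambda>b. sinh b / S b) has_field_derivative \<kappa> * cosh b / S b ^ 3) (at b)"
proof -
  have "((\<lambda>b. sinh b / S b) has_field_derivative
     (cosh b * S b - sinh b * (sinh b * cosh b / S b)) / (S b * S b)) (at b)"
    by (rule derivative_eq_intros assms refl | simp)+
  also have "cosh b * S b - sinh b * (sinh b * cosh b / S b)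
      = cosh b * ((S b)\<^sup>2 - (sinh b)\<^sup>2) / S b"
    using assms(2) by (simp add: field_simps power2_eq_square)
  finally show ?thesis
    by (simp add: assms(3) power3_eq_cube mult_ac)
qed

text \<open>
  Since \<open>(cosh b)\<^sup>2 - S\<^sup>2 = 1 - \<kappa>\<close>, the second eigenvalue \<open>exp \<beta> * (cosh b - S)\<close> is the first one times
  \<open>q\<close>. In this form \<open>q\<close> is differentiated through \<open>f\<close> alone.
\<close>
lemma eigenvalue_identities:
  fixes b f S :: "'f::{real_normed_field,banach}" and \<beta> :: real
  defines "\<kappa> \<equiv> of_real (exp (- 4 * \<beta>))"
  defines "x \<equiv> exp (of_real \<beta> + f)" and "q \<equiv> (1 - \<kappa>) * exp (- 2 * f)"
  assumes f: "exp f = cosh b + S" and S: "S\<^sup>2 = (sinh b)\<^sup>2 + \<kappa>"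
  shows "x + q * x = of_real (exp \<beta>) * (exp b + exp (- b))"
    and "x * (q * x) = of_real ((exp \<beta>)\<^sup>2 - (exp (- \<beta>))\<^sup>2)"
proof -
  have "(cosh b - S) * exp f = (cosh b)\<^sup>2 - S\<^sup>2"
    by (simp add: f algebra_simps power2_eq_square)
  also have "\<dots> = 1 - \<kappa>"
    by (simp add: S cosh_square_eq)
  finally have "q * exp f = (cosh b - S) * (exp (- 2 * f) * exp f * exp f)"
    by (simp add: q_def mult_ac)
  also have "exp (- 2 * f) * exp f * exp f = 1"
    by (simp flip: exp_add)
  finally have qx: "q * x = of_real (exp \<beta>) * (cosh b - S)"
    by (simp add: x_def exp_add exp_of_real mult_ac)
  have x: "x = of_real (exp \<beta>) * (cosh b + S)"
    by (simp add: x_def exp_add f exp_of_real)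
  show "x + q * x = of_real (exp \<beta>) * (exp b + exp (- b))"
    unfolding qx unfolding x by (simp add: cosh_def scaleR_conv_of_real algebra_simps)
  have "x * (q * x) = (of_real (exp \<beta>))\<^sup>2 * ((cosh b)\<^sup>2 - S\<^sup>2)"
    unfolding qx unfolding x by (simp add: power2_eq_square algebra_simps)
  also have "\<dots> = of_real ((exp \<beta>)\<^sup>2 * (1 - exp (- 4 * \<beta>)))"
    by (simp add: S cosh_square_eq \<kappa>_def)
  also have "(exp \<beta>)\<^sup>2 * (1 - exp (- 4 * \<beta>)) = (exp \<beta>)\<^sup>2 - (exp (- \<beta>))\<^sup>2"
    by (simp add: algebra_simps exp_add[symmetric] exp_double[symmetric])
  finally show "x * (q * x) = of_real ((exp \<beta>)\<^sup>2 - (exp (- \<beta>))\<^sup>2)" .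
qed

definition ising_root :: "real \<Rightarrow> real \<Rightarrow> real" where
  "ising_root \<kappa> b = sqrt ((sinh b)\<^sup>2 + \<kappa>)"

text \<open>
  The pressure of the one-dimensional model is \<open>\<beta> + log_growth (exp (- 4 * \<beta>)) b\<close>, and its derivative
  \<open>sinh b / ising_root \<kappa> b\<close> is the magnetization.
\<close>
definition log_growth :: "real \<Rightarrow> real \<Rightarrow> real" where
  "log_growth \<kappa> b = ln (cosh b + ising_root \<kappa> b)"

definition eigen_ratio :: "real \<Rightarrow> real \<Rightarrow> real" where
  "eigen_ratio \<kappa> b = (1 - \<kappa>) * exp (- 2 * log_growth \<kappa> b)"

context
  fixes \<kappa> :: real
  assumes \<kappa>: "0 < \<kappa>"
begin

lemma ising_root_pos [simp]: "0 < ising_root \<kappa> b"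
  using \<kappa> by (auto simp: ising_root_def intro: add_nonneg_pos)

lemma ising_root_squared: "(ising_root \<kappa> b)\<^sup>2 = (sinh b)\<^sup>2 + \<kappa>"
  using \<kappa> by (simp add: ising_root_def add_nonneg_nonneg)

lemma growth_pos [simp]: "0 < cosh b + ising_root \<kappa> b"
  by (simp add: add_pos_pos)

lemma exp_log_growth: "exp (log_growth \<kappa> b) = cosh b + ising_root \<kappa> b"
  by (simp add: log_growth_def)

lemma DERIV_ising_root:
  "(ising_root \<kappa> has_real_derivative sinh b * cosh b / ising_root \<kappa> b) (at b)"
proof -
  have "0 < (sinh b)\<^sup>2 + \<kappa>" using \<kappa> by (simp add: add_nonneg_pos)
  then show ?thesis
    unfolding ising_root_def by (auto intro!: derivative_eq_intros simp: field_simps)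
qed

lemma DERIV_log_growth:
  "(log_growth \<kappa> has_real_derivative sinh b / ising_root \<kappa> b) (at b)"
proof -
  have "((\<lambda>b. cosh b + ising_root \<kappa> b) has_real_derivative
      (cosh b + ising_root \<kappa> b) * (sinh b / ising_root \<kappa> b)) (at b)"
    by (rule DERIV_cosh_plus_root[OF DERIV_ising_root])
       (simp add: less_imp_neq[OF ising_root_pos, symmetric])
  from DERIV_chain2[OF DERIV_ln[OF growth_pos] this] show ?thesis
    unfolding log_growth_def using growth_pos[of b]
    by (simp only: mult.assoc[symmetric]) simp
qed

lemma DERIV_mean_1d:
  "((\<lambda>b. sinh b / ising_root \<kappa> b) has_real_derivative \<kappa> * cosh b / ising_root \<kappa> b ^ 3) (at b)"
  by (rule DERIV_sinh_div_root[OF DERIV_ising_root])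
     (simp_all add: ising_root_squared less_imp_neq[OF ising_root_pos, symmetric])

lemma eigen_ratio_bounds:
  assumes "\<kappa> \<le> 1"
  shows "0 \<le> eigen_ratio \<kappa> b" "eigen_ratio \<kappa> b < 1"
proof -
  show "0 \<le> eigen_ratio \<kappa> b" using assms by (simp add: eigen_ratio_def)
  have "1 < cosh b + ising_root \<kappa> b"
    using cosh_real_ge_1[of b] ising_root_pos[of b] by linarith
  then have "0 < log_growth \<kappa> b"
    by (simp add: log_growth_def)
  then have "exp (- 2 * log_growth \<kappa> b) < 1"
    by simp
  moreover have "(1 - \<kappa>) * exp (- 2 * log_growth \<kappa> b) \<le> 1 * exp (- 2 * log_growth \<kappa> b)"
    using \<kappa> by (intro mult_right_mono) auto
  ultimately show "eigen_ratio \<kappa> b < 1"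
    unfolding eigen_ratio_def by linarith
qed

lemma DERIV_eigen_ratio_power:
  "((\<lambda>b. eigen_ratio \<kappa> b ^ L) has_real_derivative
    - 2 * real L * (sinh b / ising_root \<kappa> b) * eigen_ratio \<kappa> b ^ L) (at b)"
proof -
  have "(eigen_ratio \<kappa> has_real_derivative
      - 2 * (sinh b / ising_root \<kappa> b) * eigen_ratio \<kappa> b) (at b)"
    unfolding eigen_ratio_def
    by (rule derivative_eq_intros DERIV_log_growth refl | simp)+
  note deriv = DERIV_power[OF this, of L]
  have "real L * (- 2 * d * q * q ^ (L - Suc 0)) = - 2 * real L * d * q ^ L" for d q :: real
    by (cases L) (simp_all add: algebra_simps)
  with deriv show ?thesis by (simp only:)
qed

end

lemma ln_lambda_plus: "ln (lambda_plus \<beta> b) = \<beta> + log_growth (exp (- 4 * \<beta>)) b"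
  using growth_pos[of "exp (- 4 * \<beta>)" b]
  by (simp add: lambda_plus_def log_growth_def ising_root_def ln_mult)

lemma susceptibility_1d_eq:
  "susceptibility_1d \<beta> B = exp (- 4 * \<beta>) * cosh B / ising_root (exp (- 4 * \<beta>)) B ^ 3"
proof -
  have "((\<lambda>b. ln (lambda_plus \<beta> b)) has_real_derivative sinh b / ising_root (exp (- 4 * \<beta>)) b) (at b)"
    for b
    unfolding ln_lambda_plus using DERIV_log_growth[of "exp (- 4 * \<beta>)" b]
    by (auto intro!: derivative_eq_intros)
  then have "deriv (\<lambda>b. ln (lambda_plus \<beta> b)) = (\<lambda>b. sinh b / ising_root (exp (- 4 * \<beta>)) b)"
    by (intro ext DERIV_imp_deriv)
  then show ?thesis
    using DERIV_imp_deriv[OF DERIV_mean_1d[of "exp (- 4 * \<beta>)" B]]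
    by (simp add: susceptibility_1d_def numeral_2_eq_2)
qed

lemma susceptibility_1d_closed_form:
  "susceptibility_1d \<beta> B
    = cosh B * exp (- 4 * \<beta>) / ((sinh B)\<^sup>2 + exp (- 4 * \<beta>)) powr (3 / 2)"
proof -
  let ?d = "(sinh B)\<^sup>2 + exp (- 4 * \<beta>)"
  have d: "0 < ?d" by (simp add: add_nonneg_pos)
  have "?d powr (3 / 2) = (?d powr (1 / 2)) powr 3"
    by (simp add: powr_powr)
  also have "\<dots> = sqrt ?d ^ 3"
    using d by (simp add: powr_half_sqrt powr_numeral)
  finally show ?thesis
    by (simp add: susceptibility_1d_eq ising_root_def mult.commute)
qed

section \<open>The quenched susceptibility of a union of cycles\<close>

definition quenched_mean :: "nat \<Rightarrow> real \<Rightarrow> real \<Rightarrow> multigraph \<Rightarrow> real" where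
  "quenched_mean N \<beta> b E = (\<Sum>\<sigma>\<in>spin_configs N. boltzmann_weight N \<beta> b E \<sigma> * total_spin N \<sigma>)
     / partition_function N \<beta> b E"

lemma DERIV_boltzmann_weight:
  "((\<lambda>b. boltzmann_weight N \<beta> b E \<sigma>) has_real_derivative
    boltzmann_weight N \<beta> b E \<sigma> * total_spin N \<sigma>) (at b)"
  unfolding boltzmann_weight_def total_spin_def
  by (auto intro!: derivative_eq_intros)

lemma DERIV_partition_function:
  "((\<lambda>b. partition_function N \<beta> b E) has_real_derivative
    (\<Sum>\<sigma>\<in>spin_configs N. boltzmann_weight N \<beta> b E \<sigma> * total_spin N \<sigma>)) (at b)"
  unfolding partition_function_def
  by (intro DERIV_sum DERIV_boltzmann_weight)

lemma DERIV_ln_partition_function: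
  "((\<lambda>b. ln (partition_function N \<beta> b E)) has_real_derivative quenched_mean N \<beta> b E) (at b)"
  using DERIV_chain2[OF DERIV_ln[OF partition_function_pos] DERIV_partition_function]
  by (simp add: quenched_mean_def divide_inverse mult.commute)

lemma quenched_integral:
  "integral\<^sup>L (quenched_measure N \<beta> B E) F
    = (\<Sum>\<sigma>\<in>spin_configs N. boltzmann_weight N \<beta> B E \<sigma> * F \<sigma>) / partition_function N \<beta> B E"
  for F :: "_ \<Rightarrow> real"
  unfolding quenched_measure_def
  by (subst lebesgue_integral_point_measure_finite)
     (auto simp: finite_spin_configs boltzmann_weight_def sum_divide_distrib
       intro!: divide_nonneg_pos partition_function_pos)

text \<open>
  The fluctuation relation: the derivative of the mean of the total spin in \<open>B\<close> is its variance.
\<close>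
lemma DERIV_quenched_mean:
  assumes "N \<ge> 1"
  shows "((\<lambda>b. quenched_mean N \<beta> b E) has_real_derivative
    real N * quenched_susceptibility N \<beta> b E) (at b)"
proof -
  let ?w = "boltzmann_weight N \<beta> b E"
  let ?Z = "partition_function N \<beta> b E"
  let ?M1 = "\<Sum>\<sigma>\<in>spin_configs N. ?w \<sigma> * total_spin N \<sigma>"
  let ?M2 = "\<Sum>\<sigma>\<in>spin_configs N. ?w \<sigma> * total_spin N \<sigma> * total_spin N \<sigma>"
  have Z: "?Z \<noteq> 0" using partition_function_pos[of N \<beta> b E] by simp
  have "((\<lambda>b. quenched_mean N \<beta> b E) has_real_derivative
      (?M2 * ?Z - ?M1 * ?M1) / (?Z * ?Z)) (at b)"
    unfolding quenched_mean_def
    by (intro DERIV_divide DERIV_partition_function DERIV_sum Z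
        DERIV_cmult_right[of _ _ _ _ "total_spin N _"] DERIV_boltzmann_weight)
  also have "(?M2 * ?Z - ?M1 * ?M1) / (?Z * ?Z) = real N * quenched_susceptibility N \<beta> b E"
  proof -
    have sq: "(x / sqrt (real N) - m / sqrt (real N))\<^sup>2
      = (x * x - 2 * m * x + m * m) / real N" for x m
      by (simp add: diff_divide_distrib[symmetric] power_divide power2_diff power2_eq_square algebra_simps)
    have "quenched_susceptibility N \<beta> b E
      = (\<Sum>\<sigma>\<in>spin_configs N. ?w \<sigma> * (total_spin N \<sigma> / sqrt (real N) - ?M1 / ?Z / sqrt (real N))\<^sup>2) / ?Z"
      unfolding quenched_susceptibility_def quenched_integral
      by (simp add: sum_divide_distrib mult_ac)
    also have "\<dots> = (\<Sum>\<sigma>\<in>spin_configs N. ?w \<sigma> * total_spin N \<sigma> * total_spin N \<sigma>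
        - 2 * (?M1 / ?Z) * (?w \<sigma> * total_spin N \<sigma>) + (?M1 / ?Z) * (?M1 / ?Z) * ?w \<sigma>) / real N / ?Z"
      unfolding sq by (simp add: sum_divide_distrib algebra_simps)
    also have "\<dots> = (?M2 - 2 * (?M1 / ?Z) * ?M1 + (?M1 / ?Z) * (?M1 / ?Z) * ?Z) / real N / ?Z"
      by (simp only: sum.distrib sum_subtractf sum_distrib_left[symmetric] partition_function_def)
    finally show ?thesis
      using Z assms by (simp add: field_simps)
  qed
  finally show ?thesis .
qed

lemma ising_eigenvalues:
  fixes \<beta> b :: real
  defines "\<kappa> \<equiv> exp (- 4 * \<beta>)"
  defines "x \<equiv> exp (\<beta> + log_growth \<kappa> b)" and "q \<equiv> eigen_ratio \<kappa> b"
  shows "x + q * x = exp \<beta> * (exp b + exp (- b))"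
    and "x * (q * x) = (exp \<beta>)\<^sup>2 - (exp (- \<beta>))\<^sup>2"
  using eigenvalue_identities[of "log_growth \<kappa> b" b "ising_root \<kappa> b" \<beta>]
  by (simp_all add: x_def q_def \<kappa>_def eigen_ratio_def exp_log_growth ising_root_squared)

lemma partition_function_cycles:
  assumes "P \<in> pairings (two_half_edges {1..N})"
    and ns: "\<And>(w :: real \<Rightarrow> real) m. closed_weight w m {1..N} P = prod_list (map (cycle_weight w m) ns)"
  shows "partition_function N \<beta> b (multigraph_of P) = (\<Prod>n\<leftarrow>ns. exp (\<beta> + log_growth (exp (- 4 * \<beta>)) b) ^ Suc n
     * (1 + eigen_ratio (exp (- 4 * \<beta>)) b ^ Suc n))"
proof -
  let ?\<kappa> = "exp (- 4 * \<beta>)"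
  let ?x = "exp (\<beta> + log_growth ?\<kappa> b)" and ?q = "eigen_ratio ?\<kappa> b"
  have fin: "finite P" using assms(1) by (rule finite_pairing[rotated]) simp
  have "cycle_weight (\<lambda>u. exp (\<beta> * u)) (\<lambda>u. exp (b * u)) n = ?x ^ Suc n + (?q * ?x) ^ Suc n" for n
    by (intro cycle_weight_eigenvalues) (simp_all add: ising_eigenvalues[simplified] exp_add[symmetric])
  moreover have "?x ^ k + (?q * ?x) ^ k = ?x ^ k * (1 + ?q ^ k)" for k
    by (simp add: power_mult_distrib algebra_simps)
  ultimately have "cycle_weight (\<lambda>u. exp (\<beta> * u)) (\<lambda>u. exp (b * u))
      = (\<lambda>n. ?x ^ Suc n * (1 + ?q ^ Suc n))"
    by (intro ext) (simp only:)
  moreover have "partition_function N \<beta> b (multigraph_of P)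
      = closed_weight (\<lambda>u. exp (\<beta> * u)) (\<lambda>u. exp (b * u)) {1..N} P"
    using sum_boltzmann_weight_tilted[OF fin, where z = "0::real", of N \<beta> b]
    by (simp add: partition_function_def)
  ultimately show ?thesis
    unfolding ns by (simp only:)
qed

lemma ln_prod_list:
  fixes F :: "'i \<Rightarrow> real"
  assumes "\<And>n. 0 < F n"
  shows "ln (\<Prod>n\<leftarrow>ns. F n) = (\<Sum>n\<leftarrow>ns. ln (F n))"
proof -
  have "0 < (\<Prod>n\<leftarrow>ns. F n) \<and> ln (\<Prod>n\<leftarrow>ns. F n) = (\<Sum>n\<leftarrow>ns. ln (F n))"
    by (induction ns) (auto simp: ln_mult_pos assms)
  then show ?thesis ..
qed

lemma ln_partition_function_cycles:
  assumes "P \<in> pairings (two_half_edges {1..N})" "0 \<le> \<beta>"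
    and sum: "sum_list (map Suc ns) = N"
    and ns: "\<And>(w :: real \<Rightarrow> real) m. closed_weight w m {1..N} P = prod_list (map (cycle_weight w m) ns)"
  shows "ln (partition_function N \<beta> b (multigraph_of P))
    = real N * (\<beta> + log_growth (exp (- 4 * \<beta>)) b)
    + (\<Sum>n\<leftarrow>ns. ln (1 + eigen_ratio (exp (- 4 * \<beta>)) b ^ Suc n))"
proof -
  let ?\<kappa> = "exp (- 4 * \<beta>)"
  have q: "0 \<le> eigen_ratio ?\<kappa> b"
    using assms by (intro eigen_ratio_bounds) auto
  have pos: "0 < 1 + eigen_ratio ?\<kappa> b ^ Suc n" for n
    using q by (intro add_pos_nonneg) auto
  have ln_term: "ln (exp l ^ Suc n * (1 + eigen_ratio ?\<kappa> b ^ Suc n))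
      = real (Suc n) * l + ln (1 + eigen_ratio ?\<kappa> b ^ Suc n)" for n l
    using pos[of n] by (simp only: ln_mult_pos zero_less_power exp_gt_zero ln_realpow ln_exp)
  have "(\<Sum>n\<leftarrow>ns. real (Suc n) * l + g n) = real (sum_list (map Suc ns)) * l + (\<Sum>n\<leftarrow>ns. g n)"
    for l and g :: "nat \<Rightarrow> real"
    by (induction ns) (auto simp: algebra_simps)
  then show ?thesis
    unfolding partition_function_cycles[OF assms(1) ns] unfolding sum[symmetric]
    by (subst ln_prod_list) (simp_all only: ln_term pos zero_less_power exp_gt_zero mult_pos_pos)
qed

lemma DERIV_sum_list:
  "(\<And>n. n \<in> set ns \<Longrightarrow> (f n has_real_derivative f' n) (at b)) \<Longrightarrow>
    ((\<lambda>b. \<Sum>n\<leftarrow>ns. f n b) has_real_derivative (\<Sum>n\<leftarrow>ns. f' n)) (at b)"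
  by (induction ns) (auto intro!: derivative_eq_intros)

lemma quadratic_times_power_bounded:
  assumes "0 \<le> q" "q < (1::real)"
  obtains C where "\<And>n. (real n)\<^sup>2 * q ^ n \<le> C"
proof -
  have "(\<lambda>n. (real n * sqrt q ^ n)\<^sup>2) \<longlonglongrightarrow> 0\<^sup>2"
    using assms by (intro tendsto_power powser_times_n_limit_0) auto
  then have "Bseq (\<lambda>n. (real n * sqrt q ^ n)\<^sup>2)"
    by (intro convergent_imp_Bseq convergentI)
  then obtain C where C: "\<And>n. norm ((real n * sqrt q ^ n)\<^sup>2) \<le> C"
    by (auto simp: Bseq_def)
  have "(real n * sqrt q ^ n)\<^sup>2 = (real n)\<^sup>2 * (sqrt q ^ 2) ^ n" for n
    by (simp only: power_mult_distrib power_mult[symmetric] mult.commute)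
  then have "(real n)\<^sup>2 * q ^ n \<le> C" for n
    using C[of n] assms by simp
  then show thesis by (rule that)
qed

text \<open>
  The logarithm of the partition function is differentiated twice in its cycle form. The main term
  gives the one-dimensional susceptibility exactly, and each cycle adds a term bounded uniformly in
  its length. The number of cycles appears as the logarithm of \<open>coherent_configs\<close>, so that the bound
  refers to the multigraph only.
\<close>
lemma quenched_susceptibility_bound:
  assumes "0 \<le> \<beta>"
  obtains C where "0 \<le> C" and "\<And>N P. N \<ge> 1 \<Longrightarrow> P \<in> pairings (two_half_edges {1..N}) \<Longrightarrow>
    \<bar>quenched_susceptibility N \<beta> B (multigraph_of P) - susceptibility_1d \<beta> B\<bar>
      \<le> C * ln (coherent_configs N (multigraph_of P)) / real N"
proof -
  let ?\<kappa> = "exp (- 4 * \<beta>)"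
  let ?q = "eigen_ratio ?\<kappa>"
  let ?f' = "\<lambda>b. sinh b / ising_root ?\<kappa> b"
  let ?f'' = "?\<kappa> * cosh B / ising_root ?\<kappa> B ^ 3"
  have \<kappa>: "0 < ?\<kappa>" "?\<kappa> \<le> 1" using assms by auto
  note q = eigen_ratio_bounds[OF \<kappa>]
  obtain C where C: "\<And>n. (real n)\<^sup>2 * ?q B ^ n \<le> C"
    using quadratic_times_power_bounded[OF q] by blast
  define D where "D = (2 * \<bar>?f''\<bar> + 4 * (?f' B)\<^sup>2) * C"
  \<comment> \<open>first and second derivative of \<open>ln (1 + q ^ L)\<close>, the correction from a cycle of length \<open>L\<close>\<close>
  define h where "h L b = - 2 * real L * ?f' b * (?q b ^ L / (1 + ?q b ^ L))" for L b
  define h' where "h' L = - 2 * real L * ?f'' * (?q B ^ L / (1 + ?q B ^ L))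
      + 4 * (real L)\<^sup>2 * (?f' B)\<^sup>2 * ?q B ^ L / (1 + ?q B ^ L)\<^sup>2" for L
  have pos: "0 < 1 + ?q b ^ L" for b L
    using q[of b] by (intro add_pos_nonneg) auto
  have C0: "0 \<le> C" using C[of 0] by simp
  then have D0: "0 \<le> D" by (simp add: D_def)
  have ln_deriv: "((\<lambda>b. ln (1 + ?q b ^ L)) has_real_derivative h L b) (at b)" for L b
    unfolding h_def
    by (rule derivative_eq_intros DERIV_eigen_ratio_power[OF \<kappa>(1)] refl pos | simp add: mult_ac)+
  have h_deriv: "(h L has_real_derivative h' L) (at B)" for L
  proof -
    have quot: "(c * u * (1 + u) - u * (0 + c * u)) / ((1 + u) * (1 + u)) = c * u / (1 + u)\<^sup>2"
      for c u :: real
      by (simp add: algebra_simps power2_eq_square)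
    have "((\<lambda>b. ?q b ^ L / (1 + ?q b ^ L)) has_real_derivative
       - 2 * real L * ?f' B * ?q B ^ L / (1 + ?q B ^ L)\<^sup>2) (at B)"
      using DERIV_divide[OF DERIV_eigen_ratio_power[OF \<kappa>(1), of L B]
          DERIV_add[OF DERIV_const[of 1] DERIV_eigen_ratio_power[OF \<kappa>(1), of L B]]] pos[of B L]
      unfolding quot by simp
    from DERIV_mult[OF DERIV_cmult[OF DERIV_mean_1d[OF \<kappa>(1)], of "- 2 * real L"] this]
    show ?thesis
      unfolding h_def h'_def by (simp add: algebra_simps power2_eq_square)
  qed
  have h'_bound: "\<bar>h' L\<bar> \<le> D" for L
  proof -
    let ?u = "?q B ^ L"
    have u: "0 \<le> ?u" using q by simp
    have frac: "?u / (1 + ?u) \<le> ?u" "?u / (1 + ?u)\<^sup>2 \<le> ?u"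
      using divide_left_mono[of 1 "1 + ?u" ?u] divide_left_mono[of 1 "(1 + ?u)\<^sup>2" ?u]
        one_le_power[of "1 + ?u" 2] pos[of B L] u by simp_all
    have L: "real L \<le> (real L)\<^sup>2"
      by (cases L) (auto simp: power2_eq_square)
    have "\<bar>h' L\<bar> \<le> 2 * \<bar>?f''\<bar> * (real L * (?u / (1 + ?u)))
        + 4 * (?f' B)\<^sup>2 * ((real L)\<^sup>2 * (?u / (1 + ?u)\<^sup>2))"
      unfolding h'_def by (rule order_trans[OF abs_triangle_ineq])
        (use u in \<open>simp add: abs_mult mult_ac\<close>)
    also have "\<dots> \<le> 2 * \<bar>?f''\<bar> * ((real L)\<^sup>2 * ?u) + 4 * (?f' B)\<^sup>2 * ((real L)\<^sup>2 * ?u)"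
      using frac L u by (intro add_mono mult_mono) auto
    also have "\<dots> \<le> 2 * \<bar>?f''\<bar> * C + 4 * (?f' B)\<^sup>2 * C"
      by (intro add_mono mult_left_mono C) auto
    finally show ?thesis by (simp add: D_def algebra_simps)
  qed
  show thesis
  proof (rule that[of "D / ln 2"])
    show "0 \<le> D / ln 2" using D0 by simp
    fix N :: nat and P assume N: "N \<ge> 1" and P: "P \<in> pairings (two_half_edges {1..N})"
    obtain ns where ns: "sum_list (map Suc ns) = card {1..N}"
      "\<And>w m. closed_weight w m {1..N} P = (prod_list (map (cycle_weight w m) ns) :: real)"
      by (rule cycle_decomposition[OF finite_atLeastAtMost P, where 'f=real]) (rule that)
    have mean: "quenched_mean N \<beta> b (multigraph_of P) = real N * ?f' b + (\<Sum>n\<leftarrow>ns. h (Suc n) b)"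
      for b
    proof (rule DERIV_unique[OF DERIV_ln_partition_function])
      show "((\<lambda>b. ln (partition_function N \<beta> b (multigraph_of P))) has_real_derivative
          real N * ?f' b + (\<Sum>n\<leftarrow>ns. h (Suc n) b)) (at b)"
        unfolding ln_partition_function_cycles[OF P assms ns(1)[unfolded card_atLeastAtMost, simplified] ns(2)]
        by (rule derivative_eq_intros DERIV_sum_list ln_deriv DERIV_log_growth[OF \<kappa>(1)] refl | simp)+
    qed
    have "real N * quenched_susceptibility N \<beta> B (multigraph_of P)
        = real N * ?f'' + (\<Sum>n\<leftarrow>ns. h' (Suc n))"
    proof (rule DERIV_unique[OF DERIV_quenched_mean[OF N]])
      show "((\<lambda>b. quenched_mean N \<beta> b (multigraph_of P)) has_real_derivative
          real N * ?f'' + (\<Sum>n\<leftarrow>ns. h' (Suc n))) (at B)"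
        unfolding mean
        by (intro DERIV_add DERIV_cmult DERIV_mean_1d[OF \<kappa>(1)] DERIV_sum_list h_deriv)
    qed
    then have "quenched_susceptibility N \<beta> B (multigraph_of P) - susceptibility_1d \<beta> B
        = (\<Sum>n\<leftarrow>ns. h' (Suc n)) / real N"
      using N by (simp add: susceptibility_1d_eq field_simps)
    moreover have "\<bar>\<Sum>n\<leftarrow>ns. h' (Suc n)\<bar> \<le> D * real (length ns)"
    proof (induction ns)
      case (Cons n ns)
      then show ?case
        using h'_bound[of "Suc n"] by (simp add: algebra_simps)
    qed simp
    moreover have "ln (coherent_configs N (multigraph_of P)) = real (length ns) * ln 2"
      unfolding coherent_configs_cycles[OF ns(2)] by (simp add: ln_realpow)
    ultimately show "\<bar>quenched_susceptibility N \<beta> B (multigraph_of P) - susceptibility_1d \<beta> B\<bar>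
      \<le> D / ln 2 * ln (coherent_configs N (multigraph_of P)) / real N"
      by (simp add: divide_right_mono)
  qed
qed

section \<open>Almost sure convergence of the quenched susceptibility\<close>

text \<open>
  Since \<open>E[2 ^ K] \<le> 2 * N\<close>, Markov's inequality bounds the probability of \<open>2 ^ K \<ge> N ^ 3\<close> by
  \<open>2 / N\<^sup>2\<close>. This is summable, so almost surely \<open>K\<close> is at most of order \<open>ln N\<close> for all large \<open>N\<close>.
\<close>
lemma quenched_susceptibility_tendsto:
  fixes M :: "'a measure" and G :: "nat \<Rightarrow> 'a \<Rightarrow> multigraph"
  assumes M: "prob_space M"
    and meas: "\<And>N. N \<ge> 1 \<Longrightarrow> G N \<in> measurable M (count_space UNIV)"
    and law: "\<And>N. N \<ge> 1 \<Longrightarrow> distr M (count_space UNIV) (G N) = measure_pmf (CM N (\<lambda>_. 2))"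
    and "0 \<le> \<beta>"
  shows "AE \<omega> in M. (\<lambda>N. quenched_susceptibility N \<beta> B (G N \<omega>)) \<longlonglongrightarrow> susceptibility_1d \<beta> B"
proof -
  interpret prob_space M by fact
  let ?X = "\<lambda>N. coherent_configs N"
  have X_pos: "0 \<le> ?X N E" if E: "E \<in> set_pmf (CM N (\<lambda>_. 2))" for N E
  proof -
    obtain P where P: "P \<in> pairings (two_half_edges {1..N})" "E = multigraph_of P"
      using E by (auto simp: set_pmf_CM half_edges_two)
    obtain ns where "\<And>(w :: real \<Rightarrow> real) m.
        closed_weight w m {1..N} P = prod_list (map (cycle_weight w m) ns)"
      by (rule cycle_decomposition[OF finite_atLeastAtMost P(1), where 'f=real]) (rule that)
    from coherent_configs_cycles[OF this] show ?thesis
      by (simp add: P(2))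
  qed
  have tail: "measure_pmf.prob (CM N (\<lambda>_. 2)) {E. real N ^ 3 \<le> ?X N E} \<le> 2 / real N ^ 2"
    if N: "N \<ge> 1" for N
  proof -
    have "measure_pmf.prob (CM N (\<lambda>_. 2)) {E. real N ^ 3 \<le> ?X N E}
        \<le> measure_pmf.expectation (CM N (\<lambda>_. 2)) (?X N) / real N ^ 3"
      using integral_Markov_inequality_measure[where A = "UNIV" and M = "measure_pmf (CM N (\<lambda>_. 2))"
          and u = "?X N" and c = "real N ^ 3"] N X_pos
      by (simp add: integrable_measure_pmf_finite set_pmf_CM finite_pairings finite_half_edges
          AE_measure_pmf_iff)
    also have "\<dots> \<le> (2 * real N) / real N ^ 3"
      using inv_sqrt_coeff_lower[OF N] N inv_sqrt_coeff_pos[of N]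
      unfolding expectation_coherent_configs
      by (intro divide_right_mono) (auto simp: field_simps)
    also have "\<dots> = 2 / real N ^ 2"
      using N by (simp add: field_simps power2_eq_square power3_eq_cube)
    finally show ?thesis .
  qed
  \<comment> \<open>the law of \<open>G N\<close> is prescribed for \<open>N \<ge> 1\<close> only, hence the shift\<close>
  define A where "A n = G (Suc n) -` {E. real (Suc n) ^ 3 \<le> ?X (Suc n) E} \<inter> space M" for n
  have A_sets: "A n \<in> sets M" for n
    unfolding A_def by (rule measurable_sets[OF meas]) auto
  have A_prob: "prob (A n) \<le> 2 / real (Suc n) ^ 2" for n
  proof -
    have "prob (A n) = measure (distr M (count_space UNIV) (G (Suc n))) {E. real (Suc n) ^ 3 \<le> ?X (Suc n) E}"
      unfolding A_def by (rule measure_distr[symmetric]) (auto intro: meas)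
    also have "\<dots> \<le> 2 / real (Suc n) ^ 2"
      unfolding law[of "Suc n", simplified] by (rule tail) simp
    finally show ?thesis .
  qed
  have "summable (\<lambda>n. 2 * inverse (real (Suc n) ^ 2))"
    by (intro summable_mult) (subst summable_Suc_iff, rule inverse_power_summable, simp)
  then have "summable (\<lambda>n. prob (A n))"
    by (rule summable_comparison_test'[where N = 0]) (use A_prob in \<open>simp add: divide_inverse\<close>)
  then have ev: "AE \<omega> in M. \<forall>\<^sub>F n in sequentially. \<omega> \<in> space M - A n"
    by (intro borel_cantelli_AE1 A_sets) (simp_all add: emeasure_eq_measure)
  have "AE \<omega> in M. G N \<omega> \<in> set_pmf (CM N (\<lambda>_. 2))" if "N \<ge> 1" for N
  proof -
    have "AE E in distr M (count_space UNIV) (G N). E \<in> set_pmf (CM N (\<lambda>_. 2))"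
      unfolding law[OF that] by (simp add: AE_measure_pmf_iff)
    then show ?thesis
      by (subst (asm) AE_distr_iff) (auto intro: meas[OF that])
  qed
  then have supp: "AE \<omega> in M. \<forall>N\<ge>1. G N \<omega> \<in> set_pmf (CM N (\<lambda>_. 2))"
    by (simp add: AE_all_countable)
  obtain C where C: "0 \<le> C" "\<And>N P. N \<ge> 1 \<Longrightarrow> P \<in> pairings (two_half_edges {1..N}) \<Longrightarrow>
    \<bar>quenched_susceptibility N \<beta> B (multigraph_of P) - susceptibility_1d \<beta> B\<bar>
      \<le> C * ln (coherent_configs N (multigraph_of P)) / real N"
    using quenched_susceptibility_bound[OF \<open>0 \<le> \<beta>\<close>] by metis
  show ?thesis
    using ev supp
  proof eventually_elim
    case (elim \<omega>)
    have bound: "\<forall>\<^sub>F n in sequentially.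
      \<bar>quenched_susceptibility (Suc n) \<beta> B (G (Suc n) \<omega>) - susceptibility_1d \<beta> B\<bar>
        \<le> C * ln (real (Suc n) ^ 3) / real (Suc n)"
      using elim(1)
    proof eventually_elim
      case (elim n)
      then have less: "?X (Suc n) (G (Suc n) \<omega>) < real (Suc n) ^ 3"
        by (auto simp: A_def)
      have "G (Suc n) \<omega> \<in> set_pmf (CM (Suc n) (\<lambda>_. 2))"
        using \<open>\<forall>N\<ge>1. G N \<omega> \<in> set_pmf (CM N (\<lambda>_. 2))\<close> by simp
      then obtain P where P: "P \<in> pairings (two_half_edges {1..Suc n})" "G (Suc n) \<omega> = multigraph_of P"
        by (auto simp: set_pmf_CM half_edges_two)
      obtain ns where "\<And>(w :: real \<Rightarrow> real) m.
          closed_weight w m {1..Suc n} P = prod_list (map (cycle_weight w m) ns)"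
        by (rule cycle_decomposition[OF finite_atLeastAtMost P(1), where 'f=real]) (rule that)
      from coherent_configs_cycles[OF this] have X1: "0 < ?X (Suc n) (multigraph_of P)"
        by simp
      have "\<bar>quenched_susceptibility (Suc n) \<beta> B (G (Suc n) \<omega>) - susceptibility_1d \<beta> B\<bar>
        \<le> C * ln (?X (Suc n) (multigraph_of P)) / real (Suc n)"
        unfolding P(2) by (rule C(2)) (use P in auto)
      also have "\<dots> \<le> C * ln (real (Suc n) ^ 3) / real (Suc n)"
        using less X1 C(1) unfolding P(2)
        by (intro divide_right_mono mult_left_mono) (auto simp: ln_le_cancel_iff)
      finally show ?case .
    qed
    have "(\<lambda>n. C * ln (real (Suc n) ^ 3) / real (Suc n)) \<longlonglongrightarrow> 0"
      by real_asymp
    then have "(\<lambda>n. quenched_susceptibility (Suc n) \<beta> B (G (Suc n) \<omega>) - susceptibility_1d \<beta> B) \<longlonglongrightarrow> 0"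
      by (rule tendsto_rabs_zero_cancel[OF tendsto_sandwich[OF _ bound tendsto_const, rotated]])
         simp
    then show ?case
      unfolding LIM_zero_iff by (rule LIMSEQ_imp_Suc)
  qed
qed

section \<open>Complex magnetic fields\<close>

text \<open>
  On \<open>growth_domain\<close>, an open neighbourhood of the real line, the principal branches of the square root
  and of the logarithm are holomorphic: there \<open>(sinh b)\<^sup>2 + \<kappa>\<close> has positive real part, and so has
  \<open>cosh b\<close>; since a principal square root has nonnegative real part, the argument of the
  logarithm stays in the right half-plane.
\<close>
definition complex_root :: "real \<Rightarrow> complex \<Rightarrow> complex" where
  "complex_root \<kappa> b = csqrt ((sinh b)\<^sup>2 + of_real \<kappa>)"

definition complex_growth :: "real \<Rightarrow> complex \<Rightarrow> complex" where
  "complex_growth \<kappa> b = Ln (cosh b + complex_root \<kappa> b)"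

definition growth_domain :: "real \<Rightarrow> complex set" where
  "growth_domain \<kappa> = {b. 0 < Re ((sinh b)\<^sup>2 + of_real \<kappa>) \<and> 0 < Re (cosh b)}"

lemma isCont_sinh_cosh: "isCont sinh (b::complex)" "isCont cosh (b::complex)"
  using DERIV_isCont[OF has_field_derivative_sinh[OF DERIV_ident, of b]]
    DERIV_isCont[OF has_field_derivative_cosh[OF DERIV_ident, of b]] by simp_all

lemma open_growth_domain: "open (growth_domain \<kappa>)"
proof -
  have "continuous_on UNIV (sinh :: complex \<Rightarrow> complex)" "continuous_on UNIV (cosh :: complex \<Rightarrow> complex)"
    by (auto intro!: continuous_at_imp_continuous_on isCont_sinh_cosh)
  then show ?thesis
    unfolding growth_domain_def by (intro open_Collect_conj open_Collect_less continuous_intros)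
qed

lemma of_real_cosh_sinh:
  "cosh (of_real x :: complex) = of_real (cosh x)" "sinh (of_real x :: complex) = of_real (sinh x)"
  by (simp_all add: cosh_def sinh_def exp_of_real[symmetric] scaleR_conv_of_real)

context
  fixes \<kappa> :: real
  assumes \<kappa>: "0 < \<kappa>"
begin

lemma of_real_in_growth_domain: "of_real b \<in> growth_domain \<kappa>"
  using \<kappa> by (simp add: growth_domain_def of_real_cosh_sinh power2_eq_square add_nonneg_pos
      flip: of_real_mult of_real_add)

lemma complex_root_of_real: "complex_root \<kappa> (of_real b) = of_real (ising_root \<kappa> b)"
proof -
  have "0 \<le> (sinh b)\<^sup>2 + \<kappa>" using \<kappa> by simp
  from of_real_sqrt[OF this] show ?thesis
    by (simp only: complex_root_def ising_root_def of_real_cosh_sinh of_real_add of_real_power)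
qed

lemma complex_growth_of_real: "complex_growth \<kappa> (of_real b) = of_real (log_growth \<kappa> b)"
  unfolding complex_growth_def complex_root_of_real of_real_cosh_sinh log_growth_def
  using growth_pos[OF \<kappa>, of b] by (simp add: Ln_of_real flip: of_real_add)

lemma complex_root_squared: "(complex_root \<kappa> b)\<^sup>2 = (sinh b)\<^sup>2 + of_real \<kappa>"
  by (simp add: complex_root_def)

lemma Re_complex_root_pos:
  assumes "b \<in> growth_domain \<kappa>"
  shows "0 < Re (complex_root \<kappa> b)"
proof -
  have "Re (complex_root \<kappa> b) \<noteq> 0"
  proof
    assume "Re (complex_root \<kappa> b) = 0"
    then have "Re ((complex_root \<kappa> b)\<^sup>2) \<le> 0"
      by (simp add: power2_eq_square)
    with assms show False
      by (simp add: complex_root_squared growth_domain_def)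
  qed
  then show ?thesis
    using Re_csqrt[of "(sinh b)\<^sup>2 + of_real \<kappa>"] by (simp add: complex_root_def less_le)
qed

lemma complex_root_nonzero: "b \<in> growth_domain \<kappa> \<Longrightarrow> complex_root \<kappa> b \<noteq> 0"
  using Re_complex_root_pos by fastforce

lemma Re_complex_growth_pos: "b \<in> growth_domain \<kappa> \<Longrightarrow> 0 < Re (cosh b + complex_root \<kappa> b)"
  using Re_complex_root_pos[of b] by (simp add: growth_domain_def)

lemma exp_complex_growth:
  assumes "b \<in> growth_domain \<kappa>"
  shows "exp (complex_growth \<kappa> b) = cosh b + complex_root \<kappa> b"
  using Re_complex_growth_pos[OF assms] unfolding complex_growth_def
  by (intro exp_Ln) fastforce

lemma DERIV_complex_root:
  assumes "b \<in> growth_domain \<kappa>"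
  shows "(complex_root \<kappa> has_field_derivative sinh b * cosh b / complex_root \<kappa> b) (at b)"
proof -
  have "(sinh b)\<^sup>2 + of_real \<kappa> \<notin> \<real>\<^sub>\<le>\<^sub>0"
    using assms by (auto simp: growth_domain_def complex_nonpos_Reals_iff)
  moreover have "((\<lambda>b. (sinh b)\<^sup>2 + of_real \<kappa>) has_field_derivative 2 * sinh b * cosh b) (at b)"
    by (rule derivative_eq_intros refl | simp)+
  ultimately show ?thesis
    using has_field_derivative_csqrt'[of "\<lambda>b. (sinh b)\<^sup>2 + of_real \<kappa>" "2 * sinh b * cosh b" b UNIV]
    by (simp add: complex_root_def[abs_def])
qed

lemma DERIV_complex_growth:
  assumes "b \<in> growth_domain \<kappa>"
  shows "(complex_growth \<kappa> has_field_derivative sinh b / complex_root \<kappa> b) (at b)"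
proof -
  have notin: "cosh b + complex_root \<kappa> b \<notin> \<real>\<^sub>\<le>\<^sub>0"
    using Re_complex_growth_pos[OF assms] by (auto simp: complex_nonpos_Reals_iff)
  then have "cosh b + complex_root \<kappa> b \<noteq> 0" by auto
  with DERIV_chain2[OF has_field_derivative_Ln[OF notin]
      DERIV_cosh_plus_root[OF DERIV_complex_root[OF assms] complex_root_nonzero[OF assms]]]
  show ?thesis
    unfolding complex_growth_def by (simp only: mult.assoc[symmetric]) simp
qed

lemma DERIV_complex_mean:
  assumes "b \<in> growth_domain \<kappa>"
  shows "((\<lambda>b. sinh b / complex_root \<kappa> b) has_field_derivative
    of_real \<kappa> * cosh b / complex_root \<kappa> b ^ 3) (at b)"
  by (rule DERIV_sinh_div_root[OF DERIV_complex_root complex_root_nonzero complex_root_squared])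
     (rule assms)+

end

text \<open>
  The quadratic part at \<open>b\<close> is subtracted first: what remains has a small second derivative near
  \<open>b\<close>, so a Taylor estimate of first order suffices.
\<close>
lemma second_order_expansion:
  fixes F F1 F2 :: "complex \<Rightarrow> complex"
  assumes "open U" "b \<in> U"
    and F: "\<And>z. z \<in> U \<Longrightarrow> (F has_field_derivative F1 z) (at z)"
    and F1: "\<And>z. z \<in> U \<Longrightarrow> (F1 has_field_derivative F2 z) (at z)"
    and F2: "isCont F2 b"
  shows "((\<lambda>w. (F (b + w) - F b - F1 b * w - F2 b / 2 * w\<^sup>2) / w\<^sup>2) \<longlongrightarrow> 0) (at 0)"
proof (rule tendstoI)
  fix e :: real assume e: "0 < e"
  obtain d1 where d1: "0 < d1" "ball b d1 \<subseteq> U"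
    using assms(1,2) open_contains_ball by blast
  obtain d2 where d2: "0 < d2" "\<And>z. dist z b < d2 \<Longrightarrow> dist (F2 z) (F2 b) < e / 2"
    using F2 e unfolding continuous_at_eps_delta by (meson half_gt_zero)
  define d where "d = min d1 d2"
  have d: "0 < d" using d1 d2 by (simp add: d_def)
  have in_U: "z \<in> U" if "z \<in> ball b d" for z
    using that d1 by (auto simp: d_def)
  define f where "f i = (if i = 0 then (\<lambda>z. F z - F2 b / 2 * (z - b)\<^sup>2)
     else if i = 1 then (\<lambda>z. F1 z - F2 b * (z - b)) else (\<lambda>z. F2 z - F2 b))" for i :: nat
  have "cmod (F (b + w) - F b - F1 b * w - F2 b / 2 * w\<^sup>2) \<le> e / 2 * cmod w ^ 2"
    if w: "cmod w < d" for w
  proof -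
    have "cmod (f 0 (b + w) - (\<Sum>i\<le>1. f i b * (b + w - b) ^ i / fact i))
        \<le> e / 2 * cmod (b + w - b) ^ Suc 1 / fact 1"
    proof (rule field_Taylor[of "ball b d"])
      fix i :: nat and z assume z: "z \<in> ball b d" and "i \<le> 1"
      then consider "i = 0" | "i = 1" by linarith
      then show "(f i has_field_derivative f (Suc i) z) (at z within ball b d)"
      proof cases
        case 1
        have "((\<lambda>z. F z - F2 b / 2 * (z - b)\<^sup>2) has_field_derivative F1 z - F2 b * (z - b))
          (at z within ball b d)"
          by (rule derivative_eq_intros has_field_derivative_at_within[OF F[OF in_U[OF z]]] refl | simp)+
        then show ?thesis by (simp add: 1 f_def)
      next
        case 2
        have "((\<lambda>z. F1 z - F2 b * (z - b)) has_field_derivative F2 z - F2 b) (at z within ball b d)"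
          by (rule derivative_eq_intros has_field_derivative_at_within[OF F1[OF in_U[OF z]]] refl | simp)+
        then show ?thesis by (simp add: 2 f_def)
      qed
    next
      fix z assume "z \<in> ball b d"
      then show "cmod (f (Suc 1) z) \<le> e / 2"
        using d2(2)[of z] by (simp add: f_def d_def dist_norm norm_minus_commute less_imp_le)
    qed (use w d in \<open>auto simp: dist_norm\<close>)
    then show ?thesis
      by (simp add: f_def) (simp add: algebra_simps power2_eq_square)
  qed
  then have "cmod ((F (b + w) - F b - F1 b * w - F2 b / 2 * w\<^sup>2) / w\<^sup>2) < e"
    if "w \<noteq> 0" "cmod w < d" for w
  proof -
    have "cmod ((F (b + w) - F b - F1 b * w - F2 b / 2 * w\<^sup>2) / w\<^sup>2) \<le> e / 2"
      using that \<open>\<And>w. cmod w < d \<Longrightarrow> _\<close>[of w] by (simp add: norm_divide norm_power divide_le_eq)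
    then show ?thesis using e by simp
  qed
  then show "\<forall>\<^sub>F w in at 0. dist ((F (b + w) - F b - F1 b * w - F2 b / 2 * w\<^sup>2) / w\<^sup>2) 0 < e"
    unfolding eventually_at using d by (intro exI[of _ d]) (auto simp: dist_norm)
qed

section \<open>The annealed central limit theorem\<close>

definition annealed_prob :: "nat \<Rightarrow> real \<Rightarrow> real \<Rightarrow> (nat \<Rightarrow> real) \<Rightarrow> real" where
  "annealed_prob N \<beta> B \<sigma> =
     measure_pmf.expectation (CM N (\<lambda>_. 2)) (\<lambda>E. boltzmann_weight N \<beta> B E \<sigma>)
     / measure_pmf.expectation (CM N (\<lambda>_. 2)) (partition_function N \<beta> B)"

lemma finite_set_pmf_CM: "finite (set_pmf (CM N (\<lambda>_. 2)))"
  by (simp add: set_pmf_CM finite_pairings finite_half_edges)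

lemma annealed_prob_nonneg: "0 \<le> annealed_prob N \<beta> B \<sigma>"
  unfolding annealed_prob_def
  by (intro divide_nonneg_nonneg integral_nonneg_AE AE_I2)
     (auto simp: boltzmann_weight_def less_imp_le[OF partition_function_pos])

lemma annealed_integral:
  fixes g :: "_ \<Rightarrow> 'b::{banach, second_countable_topology}"
  shows "integral\<^sup>L (annealed_measure (CM N (\<lambda>_. 2)) N \<beta> B) g
    = (\<Sum>\<sigma>\<in>spin_configs N. annealed_prob N \<beta> B \<sigma> *\<^sub>R g \<sigma>)"
  unfolding annealed_measure_def annealed_prob_def[symmetric]
  by (rule lebesgue_integral_point_measure_finite) (auto simp: finite_spin_configs annealed_prob_nonneg)

text \<open>
  The Laplace transform of the total spin under the annealed measure is a quotient of two averaged
  partition functions, at the fields \<open>B + z\<close> and \<open>B\<close>.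
\<close>
lemma annealed_prob_tilted:
  fixes x q z :: "'f::{real_normed_field,banach}" and \<beta> B :: real
  defines "\<kappa> \<equiv> exp (- 4 * \<beta>)"
  assumes "x + q * x = of_real (exp \<beta>) * (exp (of_real B + z) + exp (- (of_real B + z)))"
    and "x * (q * x) = of_real ((exp \<beta>)\<^sup>2 - (exp (- \<beta>))\<^sup>2)"
  shows "(\<Sum>\<sigma>\<in>spin_configs N. of_real (annealed_prob N \<beta> B \<sigma>) * exp (z * of_real (total_spin N \<sigma>)))
    = (x ^ N * cycle_series N q) /
      of_real (exp (\<beta> + log_growth \<kappa> B) ^ N * cycle_series N (eigen_ratio \<kappa> B))"
proof -
  have "measure_pmf.expectation (CM N (\<lambda>_. 2)) (partition_function N \<beta> B)
    = (\<Sum>\<sigma>\<in>spin_configs N. measure_pmf.expectation (CM N (\<lambda>_. 2)) (\<lambda>E. boltzmann_weight N \<beta> B E \<sigma>))"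
    unfolding partition_function_def
    by (rule Bochner_Integration.integral_sum) (rule integrable_measure_pmf_finite[OF finite_set_pmf_CM])
  also have "\<dots> = exp (\<beta> + log_growth \<kappa> B) ^ N * cycle_series N (eigen_ratio \<kappa> B)"
    using annealed_tilted[of "exp (\<beta> + log_growth \<kappa> B)" "eigen_ratio \<kappa> B" \<beta> B "0::real" N]
    by (simp add: ising_eigenvalues[of \<beta> B, folded \<kappa>_def])
  finally show ?thesis
    unfolding annealed_tilted[OF assms(2,3), symmetric]
    by (simp add: annealed_prob_def sum_divide_distrib)
qed

text \<open>
  The mean is the derivative at \<open>z = 0\<close> of the Laplace transform. It differs from \<open>N\<close> times the
  one-dimensional magnetization by the logarithmic derivative of \<open>cycle_series\<close>, which is bounded in \<open>N\<close>
  because the coefficients are at most 1 and \<open>q < 1\<close>. In the central limit theorem the exact mean may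
  thus be replaced by its leading term.
\<close>
lemma annealed_mean_bound:
  fixes \<beta> B :: real
  defines "\<kappa> \<equiv> exp (- 4 * \<beta>)"
  assumes "0 \<le> \<beta>"
  obtains C where "\<And>N. \<bar>integral\<^sup>L (annealed_measure (CM N (\<lambda>_. 2)) N \<beta> B) (total_spin N)
    - real N * (sinh B / ising_root \<kappa> B)\<bar> \<le> C"
proof -
  have \<kappa>: "0 < \<kappa>" "\<kappa> \<le> 1" using assms by (auto simp: \<kappa>_def)
  let ?x = "\<lambda>b. exp (\<beta> + log_growth \<kappa> b)" and ?q = "eigen_ratio \<kappa>" and ?m = "sinh B / ising_root \<kappa> B"
  note q = eigen_ratio_bounds[OF \<kappa>, of B]
  define T where "T N = (\<Sum>k\<le>N. cycle_coeff N k * (real k * ?q B ^ k))" for N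
  let ?D = "\<lambda>N. cycle_series N (?q B)"
  have D: "1 \<le> ?D N" for N using q(1) by (rule cycle_series_ge_1)
  \<comment> \<open>the factor \<open>Suc k\<close> in place of \<open>k\<close> matches the derivative of the geometric series\<close>
  have summ: "summable (\<lambda>k. real (Suc k) * ?q B ^ k)"
    using geometric_deriv_sums[of "?q B"] q by (simp add: sums_iff)
  define C where "C = (\<Sum>k. real (Suc k) * ?q B ^ k)"
  have T: "0 \<le> T N" "T N \<le> C" for N
  proof -
    show "0 \<le> T N"
      unfolding T_def using q by (intro sum_nonneg mult_nonneg_nonneg cycle_coeff_nonneg) auto
    have "T N \<le> (\<Sum>k\<le>N. real (Suc k) * ?q B ^ k)"
      unfolding T_def
    proof (rule sum_mono)
      fix k assume "k \<in> {..N}"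
      then have "cycle_coeff N k * (real k * ?q B ^ k) \<le> 1 * (real (Suc k) * ?q B ^ k)"
        using q by (intro mult_mono cycle_coeff_le_1 mult_nonneg_nonneg) auto
      then show "cycle_coeff N k * (real k * ?q B ^ k) \<le> real (Suc k) * ?q B ^ k" by simp
    qed
    also have "\<dots> \<le> C"
      unfolding C_def using q by (intro sum_le_suminf summ) auto
    finally show "T N \<le> C" .
  qed
  have mean: "integral\<^sup>L (annealed_measure (CM N (\<lambda>_. 2)) N \<beta> B) (total_spin N)
      = real N * ?m - 2 * ?m * (T N / ?D N)" for N
  proof -
    let ?\<Phi> = "\<lambda>b. exp (real N * (\<beta> + log_growth \<kappa> b)) * cycle_series N (?q b) / (?x B ^ N * ?D N)"
    have tilted: "(\<Sum>\<sigma>\<in>spin_configs N. annealed_prob N \<beta> B \<sigma> * exp ((b - B) * total_spin N \<sigma>)) = ?\<Phi> b" for b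
      using annealed_prob_tilted[of "?x b" "?q b" \<beta> B "b - B" N] ising_eigenvalues[of \<beta> b]
      by (simp add: \<kappa>_def exp_of_nat_mult)
    have "((\<lambda>b. \<Sum>\<sigma>\<in>spin_configs N. annealed_prob N \<beta> B \<sigma> * exp ((b - B) * total_spin N \<sigma>))
      has_real_derivative (\<Sum>\<sigma>\<in>spin_configs N. annealed_prob N \<beta> B \<sigma> * total_spin N \<sigma>)) (at B)"
      by (rule DERIV_sum) (auto intro!: derivative_eq_intros)
    then have 1: "(?\<Phi> has_real_derivative
        integral\<^sup>L (annealed_measure (CM N (\<lambda>_. 2)) N \<beta> B) (total_spin N)) (at B)"
      unfolding tilted annealed_integral by simp
    have series: "((\<lambda>b. cycle_series N (?q b)) has_real_derivative - 2 * ?m * T N) (at B)"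
    proof -
      have "((\<lambda>b. cycle_series N (?q b)) has_real_derivative
        (\<Sum>k\<le>N. cycle_coeff N k * (- 2 * real k * ?m * ?q B ^ k))) (at B)"
        unfolding cycle_series_def of_real_eq_id id_apply
        by (intro DERIV_sum DERIV_cmult DERIV_eigen_ratio_power[OF \<kappa>(1)])
      also have "(\<Sum>k\<le>N. cycle_coeff N k * (- 2 * real k * ?m * ?q B ^ k)) = - 2 * ?m * T N"
        unfolding T_def sum_distrib_left by (intro sum.cong refl) (simp only: mult_ac)
      finally show ?thesis .
    qed
    have growth: "((\<lambda>b. exp (real N * (\<beta> + log_growth \<kappa> b))) has_real_derivative
        ?x B ^ N * (real N * ?m)) (at B)"
      by (rule derivative_eq_intros DERIV_log_growth[OF \<kappa>(1)] refl | simp add: exp_of_nat_mult)+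
    have 2: "(?\<Phi> has_real_derivative
        (?x B ^ N * (real N * ?m) * ?D N + (- 2 * ?m * T N) * ?x B ^ N) / (?x B ^ N * ?D N)) (at B)"
      using DERIV_cdivide[OF DERIV_mult[OF growth series], of "?x B ^ N * ?D N"]
      by (simp add: exp_of_nat_mult)
    have alg: "(X * a * d + c * X) / (X * d) = a + c / d" if "X \<noteq> 0" "d \<noteq> 0" for X a c d :: real
      using that by (simp add: field_simps)
    have "?D N \<noteq> 0" using D[of N] by linarith
    with DERIV_unique[OF 1 2] show ?thesis
      by (subst (asm) alg) auto
  qed
  show thesis
  proof (rule that[of "2 * \<bar>?m\<bar> * C"])
    fix N
    have "T N / ?D N \<le> T N / 1" using D[of N] T by (intro divide_left_mono) auto
    then have "\<bar>T N / ?D N\<bar> \<le> C"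
      using T[of N] D[of N] by simp
    then have "2 * \<bar>?m\<bar> * \<bar>T N / ?D N\<bar> \<le> 2 * \<bar>?m\<bar> * C"
      by (intro mult_left_mono) auto
    then show "\<bar>integral\<^sup>L (annealed_measure (CM N (\<lambda>_. 2)) N \<beta> B) (total_spin N)
       - real N * ?m\<bar> \<le> 2 * \<bar>?m\<bar> * C"
      unfolding mean by (simp add: abs_mult abs_divide)
  qed
qed

lemma char_normal_density:
  assumes "0 < v"
  shows "char (density lborel (normal_density 0 (sqrt v))) t = of_real (exp (- (v * t\<^sup>2 / 2)))"
proof -
  interpret N: prob_space std_normal_distribution
    by (rule prob_space_normal_density) simp
  have "distributed std_normal_distribution lborel (\<lambda>x. x) (normal_density 0 1)"
    unfolding distributed_def by (auto simp: distr_id2)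
  then have "distributed std_normal_distribution lborel (\<lambda>x. 0 + sqrt v * x) (normal_density 0 (sqrt v))"
    using N.normal_density_affine[of "\<lambda>x. x" 0 1 "sqrt v" 0] assms by simp
  then have *: "density lborel (normal_density 0 (sqrt v)) = distr std_normal_distribution borel (\<lambda>x. sqrt v * x)"
    unfolding distributed_def by (subst distr_cong[OF refl sets_lborel[symmetric] refl]) auto
  have "char (density lborel (normal_density 0 (sqrt v))) t = char std_normal_distribution (t * sqrt v)"
    unfolding * char_def by (subst integral_distr) (auto simp: mult_ac)
  also have "\<dots> = of_real (exp (- (v * t\<^sup>2 / 2)))"
    using assms by (simp add: char_std_normal_distribution power_mult_distrib mult.commute)
  finally show ?thesis .
qed

lemma cycle_series_ratio_lim:
  fixes Q :: "nat \<Rightarrow> complex" and q :: real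
  assumes Q: "Q \<longlonglongrightarrow> of_real q" and q: "0 \<le> q" "q < 1"
  shows "(\<lambda>N. cycle_series N (Q N) / of_real (cycle_series N q)) \<longlonglongrightarrow> 1"
proof -
  let ?L = "\<Sum>k. of_real (inv_sqrt_coeff k) * (of_real q :: complex) ^ k"
  have num: "(\<lambda>N. cycle_series N (Q N)) \<longlonglongrightarrow> ?L"
    using q by (intro cycle_series_lim Q) auto
  have "(\<lambda>N. cycle_series N (of_real q :: complex)) \<longlonglongrightarrow> ?L"
    using q by (intro cycle_series_lim tendsto_const) auto
  moreover have "cycle_series N (of_real q :: complex) = of_real (cycle_series N q)" for N
    by (simp add: cycle_series_def)
  ultimately have den: "(\<lambda>N. complex_of_real (cycle_series N q)) \<longlonglongrightarrow> ?L"
    by simp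
  have "(\<lambda>N. cycle_series N q) \<longlonglongrightarrow> (\<Sum>k. of_real (inv_sqrt_coeff k) * q ^ k)"
    using q by (intro cycle_series_lim tendsto_const) auto
  from tendsto_of_real[OF this] den have "?L = of_real (\<Sum>k. inv_sqrt_coeff k * q ^ k)"
    by (intro LIMSEQ_unique[OF den]) simp
  then have "?L \<noteq> 0"
    using cycle_limit_pos[OF q] by (simp only: of_real_eq_0_iff)
  then show ?thesis
    using tendsto_divide[OF num den] by simp
qed

text \<open>
  At the field \<open>B + z\<close> with \<open>z = \<i> * t / sqrt N\<close>, the characteristic function is \<open>exp (E N)\<close> times a
  quotient of cycle corrections tending to 1. Here \<open>E N\<close> collects \<open>N\<close> times the increment of the
  complex pressure and the centering. In its second-order expansion the linear term, of order
  \<open>sqrt N\<close>, is cancelled by the mean up to \<open>O(1 / sqrt N)\<close>, and the quadratic term is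
  \<open>- \<chi> * t\<^sup>2 / 2\<close>.
\<close>
lemma annealed_char_tendsto:
  fixes \<beta> B t :: real
  assumes "0 \<le> \<beta>"
  defines "P \<equiv> \<lambda>N. annealed_measure (CM N (\<lambda>_. 2)) N \<beta> B"
  shows "(\<lambda>N. char (distr (P N) borel
      (\<lambda>\<sigma>. (total_spin N \<sigma> - integral\<^sup>L (P N) (total_spin N)) / sqrt (real N))) t)
    \<longlonglongrightarrow> of_real (exp (- (susceptibility_1d \<beta> B * t\<^sup>2 / 2)))"
proof -
  define \<kappa> where "\<kappa> = exp (- 4 * \<beta>)"
  have \<kappa>: "0 < \<kappa>" "\<kappa> \<le> 1" using assms by (auto simp: \<kappa>_def)
  let ?B = "complex_of_real B"
  let ?F = "complex_growth \<kappa>"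
  let ?U = "growth_domain \<kappa>"
  define F1 where "F1 b = sinh b / complex_root \<kappa> b" for b
  define F2 where "F2 b = of_real \<kappa> * cosh b / complex_root \<kappa> b ^ 3" for b
  define R where "R w = (?F (?B + w) - ?F ?B - F1 ?B * w - F2 ?B / 2 * w\<^sup>2) / w\<^sup>2" for w
  define m where "m N = integral\<^sup>L (P N) (total_spin N)" for N
  define z where "z N = \<i> * of_real (t / sqrt (real N))" for N :: nat
  define q where "q b = (1 - of_real \<kappa>) * exp (- 2 * ?F b)" for b
  define E where "E N = of_nat N * (?F (?B + z N) - ?F ?B) - \<i> * of_real (t * m N / sqrt (real N))" for N
  note B_dom = of_real_in_growth_domain[OF \<kappa>(1), of B]
  have F1_B: "F1 ?B = of_real (sinh B / ising_root \<kappa> B)"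
    by (simp add: F1_def complex_root_of_real[OF \<kappa>(1)] of_real_cosh_sinh)
  have F2_B: "F2 ?B = of_real (susceptibility_1d \<beta> B)"
    unfolding F2_def complex_root_of_real[OF \<kappa>(1)]
    by (simp add: of_real_cosh_sinh susceptibility_1d_eq \<kappa>_def)
  have q_B: "q ?B = of_real (eigen_ratio \<kappa> B)"
    by (simp add: q_def eigen_ratio_def complex_growth_of_real[OF \<kappa>(1)] exp_of_real[symmetric])

  have "(\<lambda>N. t / sqrt (real N)) \<longlonglongrightarrow> 0"
    by real_asymp
  from tendsto_mult[OF tendsto_const tendsto_of_real[OF this], of \<i>]
  have z_lim: "z \<longlonglongrightarrow> 0"
    by (simp add: z_def[abs_def])
  then have Bz_lim: "(\<lambda>N. ?B + z N) \<longlonglongrightarrow> ?B"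
    using tendsto_add[OF tendsto_const z_lim, of ?B] by simp
  then have dom: "\<forall>\<^sub>F N in sequentially. ?B + z N \<in> ?U"
    using open_growth_domain B_dom by (rule topological_tendstoD)

  have char_eq: "char (distr (P N) borel (\<lambda>\<sigma>. (total_spin N \<sigma> - m N) / sqrt (real N))) t
      = exp (E N) * (cycle_series N (q (?B + z N)) / of_real (cycle_series N (eigen_ratio \<kappa> B)))"
    if N: "?B + z N \<in> ?U" for N
  proof -
    let ?x = "exp (of_real \<beta> + ?F (?B + z N))"
    let ?S = "\<Sum>\<sigma>\<in>spin_configs N. of_real (annealed_prob N \<beta> B \<sigma>) * exp (z N * of_real (total_spin N \<sigma>))"
    have "char (distr (P N) borel (\<lambda>\<sigma>. (total_spin N \<sigma> - m N) / sqrt (real N))) t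
      = integral\<^sup>L (P N) (\<lambda>\<sigma>. iexp (t * ((total_spin N \<sigma> - m N) / sqrt (real N))))"
      unfolding char_def P_def annealed_measure_def by (subst integral_distr) auto
    also have "\<dots> = (\<Sum>\<sigma>\<in>spin_configs N. annealed_prob N \<beta> B \<sigma> *\<^sub>R
        iexp (t * ((total_spin N \<sigma> - m N) / sqrt (real N))))"
      unfolding P_def by (rule annealed_integral)
    also have "\<dots> = (\<Sum>\<sigma>\<in>spin_configs N. exp (- (\<i> * of_real (t * m N / sqrt (real N)))) *
        (of_real (annealed_prob N \<beta> B \<sigma>) * exp (z N * of_real (total_spin N \<sigma>))))"
    proof (intro sum.cong refl)
      fix \<sigma>
      have "\<i> * complex_of_real (t * ((total_spin N \<sigma> - m N) / sqrt (real N)))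
          = - (\<i> * of_real (t * m N / sqrt (real N))) + z N * of_real (total_spin N \<sigma>)"
        by (simp add: z_def algebra_simps diff_divide_distrib)
      then show "annealed_prob N \<beta> B \<sigma> *\<^sub>R iexp (t * ((total_spin N \<sigma> - m N) / sqrt (real N)))
          = exp (- (\<i> * of_real (t * m N / sqrt (real N)))) *
        (of_real (annealed_prob N \<beta> B \<sigma>) * exp (z N * of_real (total_spin N \<sigma>)))"
        by (simp only: exp_add scaleR_conv_of_real mult_ac)
    qed
    also have "\<dots> = exp (- (\<i> * of_real (t * m N / sqrt (real N)))) * ?S"
      by (rule sum_distrib_left[symmetric])
    also have "?S = (?x ^ N * cycle_series N (q (?B + z N))) /
        of_real (exp (\<beta> + log_growth \<kappa> B) ^ N * cycle_series N (eigen_ratio \<kappa> B))"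
      using eigenvalue_identities[of "?F (?B + z N)" "?B + z N" "complex_root \<kappa> (?B + z N)" \<beta>]
        exp_complex_growth[OF \<kappa>(1) N] complex_root_squared[OF \<kappa>(1), of "?B + z N"]
      unfolding \<kappa>_def q_def by (intro annealed_prob_tilted) simp_all
    also have "of_real (exp (\<beta> + log_growth \<kappa> B) ^ N * cycle_series N (eigen_ratio \<kappa> B))
        = exp (of_real \<beta> + ?F ?B) ^ N * complex_of_real (cycle_series N (eigen_ratio \<kappa> B))"
      by (simp add: complex_growth_of_real[OF \<kappa>(1)] exp_of_real flip: of_real_add)
    also have "exp (- (\<i> * of_real (t * m N / sqrt (real N)))) *
        (?x ^ N * cycle_series N (q (?B + z N)) /
         (exp (of_real \<beta> + ?F ?B) ^ N * complex_of_real (cycle_series N (eigen_ratio \<kappa> B))))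
      = exp (- (\<i> * of_real (t * m N / sqrt (real N)))) * (?x ^ N / exp (of_real \<beta> + ?F ?B) ^ N) *
        (cycle_series N (q (?B + z N)) / of_real (cycle_series N (eigen_ratio \<kappa> B)))"
      by simp
    also have "exp (- (\<i> * of_real (t * m N / sqrt (real N)))) * (?x ^ N / exp (of_real \<beta> + ?F ?B) ^ N)
        = exp (E N)"
      unfolding E_def exp_of_nat_mult[symmetric] exp_diff[symmetric] exp_add[symmetric]
      by (rule arg_cong[of _ _ exp]) (simp add: algebra_simps)
    finally show ?thesis .
  qed

  have E_eq: "E N = - R (z N) * of_real (t\<^sup>2) - F2 ?B / 2 * of_real (t\<^sup>2)
      - \<i> * of_real (t * ((m N - real N * (sinh B / ising_root \<kappa> B)) / sqrt (real N)))"
    if N: "N \<ge> 1" for N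
  proof -
    have Nz2: "of_nat N * (z N)\<^sup>2 = - of_real (t\<^sup>2)"
      using N by (simp add: z_def power_mult_distrib power_divide flip: of_real_power)
    have Nz: "of_nat N * z N = \<i> * of_real (t * (real N / sqrt (real N)))"
      by (simp add: z_def)
    have "?F (?B + z N) - ?F ?B = R (z N) * (z N)\<^sup>2 + F1 ?B * z N + F2 ?B / 2 * (z N)\<^sup>2"
      by (cases "z N = 0") (simp_all add: R_def)
    then have "of_nat N * (?F (?B + z N) - ?F ?B)
        = (R (z N) + F2 ?B / 2) * (of_nat N * (z N)\<^sup>2) + F1 ?B * (of_nat N * z N)"
      by (simp add: algebra_simps)
    then show ?thesis
      unfolding E_def Nz2 Nz F1_B by (simp add: algebra_simps diff_divide_distrib)
  qed
  have R_lim: "(\<lambda>N. - R (z N) * of_real (t\<^sup>2)) \<longlonglongrightarrow> 0"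
  proof (cases "t = 0")
    \<comment> \<open>for \<open>t = 0\<close> the sequence \<open>z\<close> is constantly 0 and does not approach 0 from within \<open>at 0\<close>\<close>
    case False
    have "(R \<longlongrightarrow> 0) (at 0)"
      unfolding R_def
    proof (rule second_order_expansion[OF open_growth_domain B_dom])
      show "\<And>b. b \<in> ?U \<Longrightarrow> (?F has_field_derivative F1 b) (at b)"
        unfolding F1_def by (rule DERIV_complex_growth[OF \<kappa>(1)])
      show "\<And>b. b \<in> ?U \<Longrightarrow> (F1 has_field_derivative F2 b) (at b)"
        unfolding F1_def F2_def by (rule DERIV_complex_mean[OF \<kappa>(1)])
      show "isCont F2 ?B"
        unfolding F2_def
        by (intro continuous_intros isCont_sinh_cosh DERIV_isCont[OF DERIV_complex_root[OF \<kappa>(1) B_dom]])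
           (use complex_root_nonzero[OF \<kappa>(1) B_dom] in simp)
    qed
    moreover have "filterlim z (at 0) sequentially"
      unfolding filterlim_at using z_lim False
      by (auto simp: z_def eventually_sequentially intro!: exI[of _ 1])
    ultimately have "(\<lambda>N. R (z N)) \<longlonglongrightarrow> 0"
      by (rule filterlim_compose)
    from tendsto_mult[OF tendsto_minus[OF this] tendsto_const] show ?thesis
      by simp
  qed simp
  have mean_lim: "(\<lambda>N. (m N - real N * (sinh B / ising_root \<kappa> B)) / sqrt (real N)) \<longlonglongrightarrow> 0"
  proof -
    obtain C where C: "\<And>N. \<bar>m N - real N * (sinh B / ising_root \<kappa> B)\<bar> \<le> C"
      using annealed_mean_bound[OF assms(1), of B] unfolding m_def P_def \<kappa>_def by blast
    have "(\<lambda>N. C / sqrt (real N)) \<longlonglongrightarrow> 0" by real_asymp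
    then show ?thesis
      by (rule Lim_null_comparison[rotated])
         (auto simp: abs_divide intro!: always_eventually divide_right_mono C[simplified])
  qed
  have "(\<lambda>N. - R (z N) * of_real (t\<^sup>2) - F2 ?B / 2 * of_real (t\<^sup>2)
      - \<i> * of_real (t * ((m N - real N * (sinh B / ising_root \<kappa> B)) / sqrt (real N))))
    \<longlonglongrightarrow> 0 - F2 ?B / 2 * of_real (t\<^sup>2) - \<i> * of_real (t * 0)"
    by (intro tendsto_intros R_lim mean_lim)
  then have "E \<longlonglongrightarrow> 0 - F2 ?B / 2 * of_real (t\<^sup>2) - \<i> * of_real (t * 0)"
    by (rule Lim_transform_eventually)
       (rule eventually_mono[OF eventually_ge_at_top[of 1]], simp only: E_eq)
  then have E_lim: "E \<longlonglongrightarrow> of_real (- (susceptibility_1d \<beta> B * t\<^sup>2 / 2))"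
    by (simp add: F2_B)
  have "isCont ?F ?B"
    by (rule DERIV_isCont[OF DERIV_complex_growth[OF \<kappa>(1) B_dom]])
  then have "isCont q ?B"
    unfolding q_def by (intro continuous_intros)
  then have "(\<lambda>N. q (?B + z N)) \<longlonglongrightarrow> of_real (eigen_ratio \<kappa> B)"
    unfolding q_B[symmetric] using Bz_lim by (rule isCont_tendsto_compose)
  then have "(\<lambda>N. cycle_series N (q (?B + z N)) / of_real (cycle_series N (eigen_ratio \<kappa> B))) \<longlonglongrightarrow> 1"
    by (rule cycle_series_ratio_lim) (rule eigen_ratio_bounds[OF \<kappa>])+
  from tendsto_mult[OF tendsto_exp[OF E_lim] this]
  have "(\<lambda>N. exp (E N) * (cycle_series N (q (?B + z N)) / of_real (cycle_series N (eigen_ratio \<kappa> B))))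
      \<longlonglongrightarrow> of_real (exp (- (susceptibility_1d \<beta> B * t\<^sup>2 / 2)))"
    by (simp only: exp_of_real mult_1_right)
  then show ?thesis
    unfolding m_def[symmetric]
    by (rule Lim_transform_eventually) (use dom in \<open>auto elim!: eventually_mono simp: char_eq\<close>)
qed

lemma annealed_clt:
  fixes \<beta> B :: real
  assumes "0 \<le> \<beta>"
  shows "weak_conv_m
      (\<lambda>N. let P = annealed_measure (CM N (\<lambda>_. 2)) N \<beta> B in
        distr P borel (\<lambda>\<sigma>. (total_spin N \<sigma> - integral\<^sup>L P (total_spin N)) / sqrt (real N)))
      (density lborel (normal_density 0 (sqrt (susceptibility_1d \<beta> B))))"
  unfolding Let_def
proof (rule levy_continuity)
  have \<chi>: "0 < susceptibility_1d \<beta> B"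
    unfolding susceptibility_1d_eq by (simp add: cosh_real_pos)
  show "real_distribution (distr (annealed_measure (CM N (\<lambda>_. 2)) N \<beta> B) borel
      (\<lambda>\<sigma>. (total_spin N \<sigma> - integral\<^sup>L (annealed_measure (CM N (\<lambda>_. 2)) N \<beta> B) (total_spin N)) / sqrt (real N)))"
    for N
    by (rule prob_space.real_distribution_distr[OF prob_space_annealed_measure[OF finite_set_pmf_CM]])
       (simp add: annealed_measure_def)
  show "real_distribution (density lborel (normal_density 0 (sqrt (susceptibility_1d \<beta> B))))"
    using \<chi> by (intro real_distribution.intro prob_space_normal_density real_distribution_axioms.intro) auto
  show "(\<lambda>N. char (distr (annealed_measure (CM N (\<lambda>_. 2)) N \<beta> B) borel
      (\<lambda>\<sigma>. (total_spin N \<sigma> - integral\<^sup>L (annealed_measure (CM N (\<lambda>_. 2)) N \<beta> B) (total_spin N)) / sqrt (real N))) t)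
    \<longlonglongrightarrow> char (density lborel (normal_density 0 (sqrt (susceptibility_1d \<beta> B)))) t" for t
    unfolding char_normal_density[OF \<chi>] by (rule annealed_char_tendsto[OF assms])
qed

theorem theorem1p6:
  fixes M :: "'a measure" and G :: "nat \<Rightarrow> 'a \<Rightarrow> multigraph" and \<beta> B :: real
  assumes "prob_space M"
    and "\<And>N. N \<ge> 1 \<Longrightarrow> G N \<in> measurable M (count_space UNIV)"
    and "\<And>N. N \<ge> 1 \<Longrightarrow> distr M (count_space UNIV) (G N) = measure_pmf (CM N (\<lambda>_. 2))"
    and "\<beta> \<ge> 0"
  shows "\<exists>chi.
    (AE \<omega> in M. (\<lambda>N. quenched_susceptibility N \<beta> B (G N \<omega>)) \<longlonglongrightarrow> chi) \<and>
    weak_conv_m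
      (\<lambda>N. let P = annealed_measure (CM N (\<lambda>_. 2)) N \<beta> B in
        distr P borel (\<lambda>\<sigma>. (total_spin N \<sigma> - integral\<^sup>L P (total_spin N)) / sqrt (real N)))
      (density lborel (normal_density 0 (sqrt chi))) \<and>
    chi = susceptibility_1d \<beta> B \<and>
    susceptibility_1d \<beta> B
      = cosh B * exp (- 4 * \<beta>) / ((sinh B)\<^sup>2 + exp (- 4 * \<beta>)) powr (3 / 2)"
  using quenched_susceptibility_tendsto[OF assms] annealed_clt[OF assms(4)]
    susceptibility_1d_closed_form by blast

end
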